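(* Let $(A,B)$ be a concave monotone pair in $\mathbb{M}_n$ and let $\Phi:\mathbb{M}_n\to\mathbb{M}_d$ be a unital positive linear map. Then $$|\Phi(A)\Phi(B)|\prec_{\mathrm{wlog}}\Phi(AB),$$ that is, for every $k=1,\dots,d$, $$\prod_{j\le k}\lambda_j\big[\,|\Phi(A)\Phi(B)|\,\big]\le\prod_{j\le k}\lambda_j[\Phi(AB)].$$
   Context: $\mathbb{M}_n$ is the algebra of $n\times n$ complex matrices. A pair $(A,B)$ of matrices in $\mathbb{M}_n$ is a monotone pair if there exist a positive semidefinite $C\in\mathbb{M}_n$ and two non-negative, non-decreasing functions $f,g$ on $[0,\infty)$ such that $A=f(C)$ and $B=g(C)$ (functional calculus). A monotone pair $(A,B)$ is concave if $A=h(B)$ for some concave function $h:[0,\infty)\to[0,\infty)$. A linear map $\Phi$ is positive if it maps positive semidefinite matrices to positive semidefinite matrices, and unital if $\Phi(I)=I$. $|X|=(X^*X)^{1/2}$. For a positive semidefinite matrix $X$, $\lambda_1[X]\ge\lambda_2[X]\ge\cdots$ are its eigenvalues in decreasing order, counted with multiplicity. For positive semidefinite $X,Y$, the weak log-majorization $X\prec_{\mathrm{wlog}}Y$ means $\prod_{j\le k}\lambda_j[X]\le\prod_{j\le k}\lambda_j[Y]$ for all $k$. *)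

theory Defs
  imports
    "HOL-Analysis.Convex"
    "Jordan_Normal_Form.Schur_Decomposition"
begin

text \<open>
  The algebra of $n \times n$ complex matrices is \<^term>\<open>carrier_mat n n :: complex mat set\<close>.
\<close>

definition unitary_mat :: "nat \<Rightarrow> complex mat \<Rightarrow> bool" where
  "unitary_mat n U \<longleftrightarrow> U \<in> carrier_mat n n \<and> mat_adjoint U * U = 1\<^sub>m n"

text \<open>
  The order on \<^typ>\<open>complex\<close> is that of \<^theory>\<open>HOL-Library.Complex_Order\<close>: \<open>0 \<le> z\<close> says that
  \<open>z\<close> is real and nonnegative, so a positive semidefinite matrix is in particular Hermitian.
\<close>

definition psd :: "nat \<Rightarrow> complex mat \<Rightarrow> bool" where
  "psd n A \<longleftrightarrow> A \<in> carrier_mat n n \<and> (\<forall>v \<in> carrier_vec n. 0 \<le> (A *\<^sub>v v) \<bullet>c v)"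

text \<open>
  Functional calculus: \<open>spectral_fun f C M\<close> says that \<open>C = U diag(r) U\<^sup>*\<close> and
  \<open>M = U diag(f(r)) U\<^sup>*\<close> for some unitary \<open>U\<close> and real \<open>r\<close>. For Hermitian \<open>C\<close> such a
  decomposition exists, and \<open>M\<close> does not depend on its choice (lemma \<open>mat_fun_eqI\<close> below), so
  that \<open>mat_fun f C\<close> is the matrix $f(C)$. It is unspecified if \<open>C\<close> is not Hermitian.
\<close>

definition spectral_fun :: "(real \<Rightarrow> real) \<Rightarrow> complex mat \<Rightarrow> complex mat \<Rightarrow> bool" where
  "spectral_fun f C M \<longleftrightarrow>
     (\<exists>n U r. unitary_mat n U
        \<and> C = U * mat_diag n (\<lambda>i. complex_of_real (r i)) * mat_adjoint U
        \<and> M = U * mat_diag n (\<lambda>i. complex_of_real (f (r i))) * mat_adjoint U)"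

definition mat_fun :: "(real \<Rightarrow> real) \<Rightarrow> complex mat \<Rightarrow> complex mat" where
  "mat_fun f C = (THE M. spectral_fun f C M)"

lemma mat_adjoint_carrier:
  "A \<in> carrier_mat m n \<Longrightarrow> mat_adjoint A \<in> carrier_mat n m"
  by (auto simp: mat_adjoint_def)

lemma unitary_mat_right_inverse:
  assumes "unitary_mat n U"
  shows "U * mat_adjoint U = 1\<^sub>m n"
  using assms mat_mult_left_right_inverse[of "mat_adjoint U" n U]
  by (auto simp: unitary_mat_def mat_adjoint_carrier)

lemma spectral_fun_unique:
  assumes "spectral_fun f C M" "spectral_fun f C M'"
  shows "M = M'"
proof -
  let ?D = "\<lambda>n r. mat_diag n (\<lambda>i. complex_of_real (r i))"
  obtain n U r where U: "unitary_mat n U" and CU: "C = U * ?D n r * mat_adjoint U"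
    and M: "M = U * ?D n (\<lambda>i. f (r i)) * mat_adjoint U"
    using assms(1) unfolding spectral_fun_def by blast
  obtain n' V s where V': "unitary_mat n' V" and CV': "C = V * ?D n' s * mat_adjoint V"
    and M': "M' = V * ?D n' (\<lambda>i. f (s i)) * mat_adjoint V"
    using assms(2) unfolding spectral_fun_def by blast
  have "dim_row U = n" "dim_row V = n'" using U V' by (auto simp: unitary_mat_def)
  then have nn: "n' = n"
    using arg_cong[OF CU, of dim_row] arg_cong[OF CV', of dim_row] by simp
  note V = V'[unfolded nn] and CV = CV'[unfolded nn] and M' = M'[unfolded nn]
  have cU: "U \<in> carrier_mat n n" and cV: "V \<in> carrier_mat n n"
    using U V by (auto simp: unitary_mat_def)
  note cA = mat_adjoint_carrier[OF cU] mat_adjoint_carrier[OF cV]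
  have UU: "mat_adjoint U * U = 1\<^sub>m n" "mat_adjoint V * V = 1\<^sub>m n"
    using U V by (auto simp: unitary_mat_def)
  note UU' = unitary_mat_right_inverse[OF U] unitary_mat_right_inverse[OF V]
  define W where "W = mat_adjoint V * U"
  have cW: "W \<in> carrier_mat n n" using cA cU unfolding W_def by simp
  have cD: "?D n q \<in> carrier_mat n n" for q by simp
  note assoc = assoc_mult_mat[of _ n n _ n _ n] mult_carrier_mat[of _ n n _ n]
    right_mult_one_mat[of _ n n] left_mult_one_mat[of _ n n]
  have conj_eq: "mat_adjoint V * (U * ?D n q * mat_adjoint U) * U = W * ?D n q" for q
    using cU cV cA cD[of q] UU(1) unfolding W_def by (simp add: assoc)
  have conj_eq': "mat_adjoint V * (V * ?D n q * mat_adjoint V) * U = ?D n q * W" for q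
  proof -
    have "mat_adjoint V * (V * ?D n q * mat_adjoint V) * U
        = (mat_adjoint V * V) * (?D n q * (mat_adjoint V * U))"
      using cU cV cA cD[of q] by (simp add: assoc)
    then show ?thesis
      using cW cD[of q] unfolding UU W_def[symmetric] by (simp add: assoc)
  qed
  have "W * ?D n r = ?D n s * W"
    using conj_eq[of r] conj_eq'[of s] unfolding CU[symmetric] CV[symmetric] by simp
  then have ent: "W $$ (i, j) * complex_of_real (r j) = complex_of_real (s i) * W $$ (i, j)"
    if "i < n" "j < n" for i j
    using that unfolding mat_diag_mult_left[OF cW] mat_diag_mult_right[OF cW]
    by (metis (no_types, lifting) case_prod_conv index_mat(1))
  have "W * ?D n (\<lambda>i. f (r i)) = ?D n (\<lambda>i. f (s i)) * W"
    unfolding mat_diag_mult_left[OF cW] mat_diag_mult_right[OF cW]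
  proof (rule eq_matI, goal_cases)
    case (1 i j)
    then show ?case using ent[of i j] by (cases "W $$ (i, j) = 0") auto
  qed auto
  then have eq: "mat_adjoint V * M * U = mat_adjoint V * M' * U"
    unfolding M M' using conj_eq conj_eq' by simp
  have cM: "M \<in> carrier_mat n n" "M' \<in> carrier_mat n n"
    unfolding M M' using cU cV cA by auto
  have cancel: "V * (mat_adjoint V * X * U) * mat_adjoint U = X"
    if X: "X \<in> carrier_mat n n" for X
  proof -
    have "V * (mat_adjoint V * X * U) * mat_adjoint U
        = (V * mat_adjoint V) * (X * (U * mat_adjoint U))"
      using cU cV cA X by (simp add: assoc)
    then show ?thesis unfolding UU' using X by (simp add: assoc)
  qed
  show ?thesis by (rule trans[OF cancel[OF cM(1), symmetric, unfolded eq] cancel[OF cM(2)]])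
qed

lemma mat_fun_eqI: "spectral_fun f C M \<Longrightarrow> mat_fun f C = M"
  unfolding mat_fun_def by (blast intro: the_equality spectral_fun_unique)

definition mat_abs :: "complex mat \<Rightarrow> complex mat" where
  "mat_abs X = mat_fun sqrt (mat_adjoint X * X)"

definition monotone_pair :: "nat \<Rightarrow> complex mat \<Rightarrow> complex mat \<Rightarrow> bool" where
  "monotone_pair n A B \<longleftrightarrow>
     (\<exists>C f g. psd n C
        \<and> f \<in> {0..} \<rightarrow> {0..} \<and> mono_on {0..} f
        \<and> g \<in> {0..} \<rightarrow> {0..} \<and> mono_on {0..} g
        \<and> A = mat_fun f C \<and> B = mat_fun g C)"

definition concave_monotone_pair :: "nat \<Rightarrow> complex mat \<Rightarrow> complex mat \<Rightarrow> bool" where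
  "concave_monotone_pair n A B \<longleftrightarrow>
     monotone_pair n A B
     \<and> (\<exists>h. h \<in> {0..} \<rightarrow> {0..} \<and> concave_on {0..} h \<and> A = mat_fun h B)"

definition linear_mat_map :: "nat \<Rightarrow> nat \<Rightarrow> (complex mat \<Rightarrow> complex mat) \<Rightarrow> bool" where
  "linear_mat_map n d \<Phi> \<longleftrightarrow>
     \<Phi> \<in> carrier_mat n n \<rightarrow> carrier_mat d d
     \<and> (\<forall>X \<in> carrier_mat n n. \<forall>Y \<in> carrier_mat n n. \<Phi> (X + Y) = \<Phi> X + \<Phi> Y)
     \<and> (\<forall>c. \<forall>X \<in> carrier_mat n n. \<Phi> (c \<cdot>\<^sub>m X) = c \<cdot>\<^sub>m \<Phi> X)"

definition positive_map :: "nat \<Rightarrow> nat \<Rightarrow> (complex mat \<Rightarrow> complex mat) \<Rightarrow> bool" where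
  "positive_map n d \<Phi> \<longleftrightarrow> (\<forall>X. psd n X \<longrightarrow> psd d (\<Phi> X))"

definition unital_map :: "nat \<Rightarrow> nat \<Rightarrow> (complex mat \<Rightarrow> complex mat) \<Rightarrow> bool" where
  "unital_map n d \<Phi> \<longleftrightarrow> \<Phi> (1\<^sub>m n) = 1\<^sub>m d"

text \<open>
  \<open>eig_val j X\<close> is $\lambda_j[X]$, with \<open>j\<close> counted from 1. The eigenvalues with multiplicity are
  the roots of the characteristic polynomial; they are real for Hermitian \<open>X\<close>, so taking real
  parts loses nothing there.
\<close>

definition eig_val :: "nat \<Rightarrow> complex mat \<Rightarrow> real" where
  "eig_val j X = rev (sorted_list_of_multiset (image_mset Re (proots (char_poly X)))) ! (j - 1)"

definition weak_log_majorized :: "nat \<Rightarrow> complex mat \<Rightarrow> complex mat \<Rightarrow> bool" where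
  "weak_log_majorized d X Y \<longleftrightarrow>
     (\<forall>k \<in> {1..d}. (\<Prod>j = 1..k. eig_val j X) \<le> (\<Prod>j = 1..k. eig_val j Y))"

end

theory Submission
  imports Defs
begin

text \<open>
  Diagonalise \<open>C\<close>; then \<open>B\<close> and \<open>A\<close> have eigenvalues \<open>b\<^sub>i\<close> and \<open>a\<^sub>i = h(b\<^sub>i)\<close> in a common
  eigenbasis. Concavity enters only through the fact that \<open>m\<^sub>i = b\<^sub>i / a\<^sub>i\<close> increases with \<open>a\<^sub>i\<close>.
  Write \<open>X, Y, N, G\<close> for the images of \<open>B, A, B/A, AB\<close> under the map. The singular values of
  \<open>X Y = (X N\<^sup>-\<^sup>1\<^sup>/\<^sup>2) (N\<^sup>1\<^sup>/\<^sup>2 Y)\<close> are log-majorized by the products of those of the two factors, and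
  each squared singular value of either factor is at most the corresponding eigenvalue of \<open>G\<close>:
  for the first factor since \<open>X N\<^sup>-\<^sup>1 X \<le> G\<close> (Cauchy--Schwarz), and for the second because
  Chebyshev's inequality in the state given by \<open>w = Y u\<close> shows that
  \<open>\<langle>N Y u, Y u\<rangle> \<ge> c \<parallel>u\<parallel>\<^sup>2\<close> forces \<open>\<langle>G w, w\<rangle> \<ge> c \<parallel>w\<parallel>\<^sup>2\<close>. The product inequality is
  obtained, without inverting \<open>N\<close>, by comparing determinants of compressions to the top \<open>k\<close>
  singular vectors.
\<close>

subsection \<open>Spectral decomposition of Hermitian matrices\<close>

lemma dim_mat_adjoint [simp]:
  "dim_row (mat_adjoint A) = dim_col A" "dim_col (mat_adjoint A) = dim_row A"
  by (simp_all add: mat_adjoint_def)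

lemma mat_adjoint_index [simp]:
  fixes A :: "complex mat"
  assumes "i < dim_col A" "j < dim_row A"
  shows "mat_adjoint A $$ (i, j) = cnj (A $$ (j, i))"
  using assms by (simp add: mat_adjoint_def mat_of_rows_def)

lemma mat_adjoint_adjoint [simp]: "mat_adjoint (mat_adjoint A) = (A :: complex mat)"
  by (rule eq_matI) auto

lemma mat_adjoint_mult:
  fixes A B :: "complex mat"
  assumes "A \<in> carrier_mat m n" "B \<in> carrier_mat n k"
  shows "mat_adjoint (A * B) = mat_adjoint B * mat_adjoint A"
  using assms by (intro eq_matI) (auto simp: scalar_prod_def mult.commute intro!: sum.cong)

lemma mat_adjoint_mult3:
  fixes A B C :: "complex mat"
  assumes "A \<in> carrier_mat m n" "B \<in> carrier_mat n k" "C \<in> carrier_mat k l"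
  shows "mat_adjoint (A * B * C) = mat_adjoint C * (mat_adjoint B * mat_adjoint A)"
  unfolding mat_adjoint_mult[OF mult_carrier_mat[OF assms(1,2)] assms(3)]
    mat_adjoint_mult[OF assms(1,2)] ..

lemma mat_adjoint_diag: "mat_adjoint (mat_diag n f) = mat_diag n (\<lambda>i. cnj (f i))"
  by (rule eq_matI) (auto simp: mat_diag_def)

lemma mat_adjoint_one [simp]: "mat_adjoint (1\<^sub>m n :: complex mat) = 1\<^sub>m n"
  by (rule eq_matI) auto

lemma cscalar_prod_sum:
  fixes v w :: "complex vec"
  assumes "w \<in> carrier_vec n"
  shows "v \<bullet>c w = (\<Sum>i<n. v $ i * cnj (w $ i))"
  using assms by (auto simp: scalar_prod_def atLeast0LessThan intro!: sum.cong)

lemma cscalar_prod_adjoint: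
  fixes A :: "complex mat"
  assumes A: "A \<in> carrier_mat m n" and v: "v \<in> carrier_vec n" and w: "w \<in> carrier_vec m"
  shows "(A *\<^sub>v v) \<bullet>c w = v \<bullet>c (mat_adjoint A *\<^sub>v w)"
proof -
  have "(A *\<^sub>v v) \<bullet>c w = (\<Sum>i<m. \<Sum>j<n. A $$ (i, j) * v $ j * cnj (w $ i))"
    using A v unfolding cscalar_prod_sum[OF w]
    by (auto simp: scalar_prod_def atLeast0LessThan sum_distrib_right intro!: sum.cong)
  also have "\<dots> = (\<Sum>j<n. \<Sum>i<m. A $$ (i, j) * v $ j * cnj (w $ i))"
    by (rule sum.swap)
  also have "\<dots> = v \<bullet>c (mat_adjoint A *\<^sub>v w)"
    using A w unfolding cscalar_prod_sum[OF mult_mat_vec_carrier[OF mat_adjoint_carrier[OF A] w]]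
    by (auto simp: scalar_prod_def atLeast0LessThan sum_distrib_left mult_ac intro!: sum.cong)
  finally show ?thesis .
qed

lemma Re_cscalar_prod_self:
  assumes "v \<in> carrier_vec n"
  shows "v \<bullet>c v = complex_of_real (Re (v \<bullet>c v))" "0 \<le> Re (v \<bullet>c v)"
    and "v \<noteq> 0\<^sub>v n \<Longrightarrow> 0 < Re (v \<bullet>c v)"
proof -
  have "0 \<le> v \<bullet>c v" by blast
  then show "v \<bullet>c v = complex_of_real (Re (v \<bullet>c v))" "0 \<le> Re (v \<bullet>c v)"
    by (auto simp: less_eq_complex_def complex_eq_iff)
  show "0 < Re (v \<bullet>c v)" if "v \<noteq> 0\<^sub>v n"
    using conjugate_square_greater_0_vec[OF assms] that by (auto simp: less_complex_def)
qed

section \<open>Unitary diagonalisation of Hermitian matrices\<close>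

lemma unitary_mat_completion:
  fixes v :: "complex vec"
  assumes v: "v \<in> carrier_vec n" "v \<noteq> 0\<^sub>v n"
  obtains W c where "unitary_mat n W" "col W 0 = c \<cdot>\<^sub>v v" "c \<noteq> 0"
proof -
  interpret cof_vec_space n "TYPE(complex)" .
  \<comment> \<open>Gram--Schmidt keeps the first vector of the list as it is, so the orthogonal
    basis \<open>ws\<close> still starts with \<open>v\<close>; its members become unit vectors only
    after division by \<open>q\<close>.\<close>
  define ws where "ws = gram_schmidt n (basis_completion v)"
  note bc = basis_completion[OF v]
  have n: "0 < n" using v by (cases n) auto
  obtain vs where bv: "basis_completion v = v # vs"
    using bc(6,7) n by (cases "basis_completion v") auto
  have ws: "set ws \<subseteq> carrier_vec n" "corthogonal ws" "length ws = n"
    using gram_schmidt_result[OF bc(2) bc(4) bc(5) refl, folded ws_def] bc(6) by auto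
  have ws0: "ws ! 0 = v"
    using gram_schmidt_hd[OF v(1), of vs] ws(3) n
    by (metis bv hd_conv_nth list.size(3) not_less_zero ws_def)
  have wsc: "ws ! i \<in> carrier_vec n" if "i < n" for i using ws that by auto
  \<comment> \<open>The case \<open>i = j\<close> says that no member of \<open>ws\<close> is
    orthogonal to itself, so none vanishes and the division by \<open>q\<close> makes sense.\<close>
  have orth: "ws ! i \<bullet>c ws ! j = 0 \<longleftrightarrow> i \<noteq> j" if "i < n" "j < n" for i j
    using corthogonalD[OF ws(2)] ws(3) that by auto
  define q where "q i = sqrt (Re (ws ! i \<bullet>c ws ! i))" for i
  have q: "q i \<noteq> 0" "ws ! i \<bullet>c ws ! i = complex_of_real (q i * q i)" if "i < n" for i
  proof -
    note p = Re_cscalar_prod_self[OF wsc[OF that]]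
    have "Re (ws ! i \<bullet>c ws ! i) \<noteq> 0" using orth[OF that that] p(1) by force
    then show "q i \<noteq> 0" "ws ! i \<bullet>c ws ! i = complex_of_real (q i * q i)"
      using p by (auto simp: q_def)
  qed
  define W where "W = mat n n (\<lambda>(i, j). ws ! j $ i / complex_of_real (q j))"
  have cW: "W \<in> carrier_mat n n" by (simp add: W_def)
  have "mat_adjoint W * W = 1\<^sub>m n"
  proof (rule eq_matI)
    fix i j assume "i < dim_row (1\<^sub>m n)" "j < dim_col (1\<^sub>m n)"
    then have ij: "i < n" "j < n" by auto
    have "(mat_adjoint W * W) $$ (i, j) = (\<Sum>l<n. cnj (W $$ (l, i)) * W $$ (l, j))"
      using cW ij by (auto simp: scalar_prod_def atLeast0LessThan intro!: sum.cong)
    also have "\<dots> = (\<Sum>l<n. ws ! j $ l * cnj (ws ! i $ l)) / complex_of_real (q i * q j)"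
      using ij by (auto simp: W_def sum_divide_distrib mult.commute intro!: sum.cong)
    also have "\<dots> = (ws ! j \<bullet>c ws ! i) / complex_of_real (q i * q j)"
      by (simp add: cscalar_prod_sum[OF wsc[OF ij(1)]])
    also have "\<dots> = 1\<^sub>m n $$ (i, j)"
      using orth[OF ij(2,1)] q[OF ij(1)] ij by (cases "i = j") auto
    finally show "(mat_adjoint W * W) $$ (i, j) = 1\<^sub>m n $$ (i, j)" .
  qed (use cW in auto)
  moreover have "col W 0 = (1 / complex_of_real (q 0)) \<cdot>\<^sub>v v"
    using n v ws0 by (intro eq_vecI) (auto simp: W_def)
  ultimately show thesis
    using that[of W "1 / complex_of_real (q 0)"] cW q(1)[OF n] by (auto simp: unitary_mat_def)
qed

lemma unitary_mat_conj_cancel: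
  assumes W: "unitary_mat n W" and A: "A \<in> carrier_mat n n"
  shows "W * (mat_adjoint W * A * W) * mat_adjoint W = A"
    "mat_adjoint W * (W * A * mat_adjoint W) * W = A"
proof -
  have c: "W \<in> carrier_mat n n" "mat_adjoint W \<in> carrier_mat n n"
    using W by (auto simp: unitary_mat_def mat_adjoint_carrier)
  note ass = assoc_mult_mat[of _ n n _ n _ n] mult_carrier_mat[of _ n n _ n]
  have "W * (mat_adjoint W * A * W) * mat_adjoint W = (W * mat_adjoint W) * (A * (W * mat_adjoint W))"
    using c A by (simp add: ass)
  then show "W * (mat_adjoint W * A * W) * mat_adjoint W = A"
    using A by (simp add: unitary_mat_right_inverse[OF W])
  have "mat_adjoint W * (W * A * mat_adjoint W) * W = (mat_adjoint W * W) * (A * (mat_adjoint W * W))"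
    using c A by (simp add: ass)
  then show "mat_adjoint W * (W * A * mat_adjoint W) * W = A"
    using A W by (simp add: unitary_mat_def)
qed

lemma unitary_mat_mult:
  assumes "unitary_mat n U" "unitary_mat n V"
  shows "unitary_mat n (U * V)"
proof -
  have c: "U \<in> carrier_mat n n" "V \<in> carrier_mat n n"
    "mat_adjoint U \<in> carrier_mat n n" "mat_adjoint V \<in> carrier_mat n n"
    using assms by (auto simp: unitary_mat_def mat_adjoint_carrier)
  note ass = assoc_mult_mat[of _ n n _ n _ n] mult_carrier_mat[of _ n n _ n]
  have "mat_adjoint (U * V) * (U * V) = mat_adjoint V * ((mat_adjoint U * U) * V)"
    using c by (simp add: mat_adjoint_mult[OF c(1,2)] ass)
  also have "\<dots> = 1\<^sub>m n" using assms c by (simp add: unitary_mat_def)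
  finally show ?thesis using c by (simp add: unitary_mat_def)
qed

lemma similar_mat_unitary:
  assumes W: "unitary_mat n W" and A: "A \<in> carrier_mat n n"
  shows "similar_mat (W * A * mat_adjoint W) A"
proof -
  have c: "W \<in> carrier_mat n n" "mat_adjoint W \<in> carrier_mat n n" "mat_adjoint W * W = 1\<^sub>m n"
    using W by (auto simp: unitary_mat_def mat_adjoint_carrier)
  have "similar_mat_wit (W * A * mat_adjoint W) A W (mat_adjoint W)"
    by (rule similar_mat_witI[where n = n]) (use c A unitary_mat_right_inverse[OF W] in auto)
  then show ?thesis unfolding similar_mat_def by blast
qed

lemma mat_adjoint_four_block:
  fixes A :: "complex mat"
  assumes "A \<in> carrier_mat n1 m1" "B \<in> carrier_mat n1 m2" "C \<in> carrier_mat n2 m1" "D \<in> carrier_mat n2 m2"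
  shows "mat_adjoint (four_block_mat A B C D) =
    four_block_mat (mat_adjoint A) (mat_adjoint C) (mat_adjoint B) (mat_adjoint D)"
  using assms by (intro eq_matI) auto

lemma mult_block_diag:
  fixes A1 :: "complex mat"
  assumes "A1 \<in> carrier_mat n1 n1" "A2 \<in> carrier_mat n1 n1"
    and "D1 \<in> carrier_mat n2 n2" "D2 \<in> carrier_mat n2 n2"
  shows "four_block_mat A1 (0\<^sub>m n1 n2) (0\<^sub>m n2 n1) D1 * four_block_mat A2 (0\<^sub>m n1 n2) (0\<^sub>m n2 n1) D2 =
    four_block_mat (A1 * A2) (0\<^sub>m n1 n2) (0\<^sub>m n2 n1) (D1 * D2)"
  unfolding mult_four_block_mat[OF assms(1) zero_carrier_mat zero_carrier_mat assms(3)
      assms(2) zero_carrier_mat zero_carrier_mat assms(4)]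
  using assms left_add_zero_mat[OF mult_carrier_mat[OF assms(3,4)]]
    right_add_zero_mat[OF mult_carrier_mat[OF assms(1,2)]] by simp

text \<open>Deflation: an eigenvector for the first root, completed to a unitary \<open>W\<close>,
  splits off a 1 by 1 block, and the other block has the remaining product as its characteristic
  polynomial. The diagonal follows the order of the list \<open>es\<close>, so any ordering of the
  roots can be realised.\<close>

lemma hermitian_unitary_diag:
  fixes A :: "complex mat"
  assumes "A \<in> carrier_mat n n" "mat_adjoint A = A" "char_poly A = (\<Prod>e\<leftarrow>es. [:- e, 1:])"
  shows "\<exists>U. unitary_mat n U \<and> A = U * mat_diag n (\<lambda>i. es ! i) * mat_adjoint U"
  using assms
proof (induction es arbitrary: n A)
  case Nil
  then have "n = 0" using degree_monic_char_poly[OF Nil(1)] by auto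
  then show ?case using Nil by (intro exI[of _ "1\<^sub>m 0"]) (auto simp: unitary_mat_def)
next
  case (Cons e es n A)
  have monic: "monic (\<Prod>e\<leftarrow>es. [:- e, 1:])" by (rule monic_prod_list) auto
  have cp: "char_poly A = [:- e, 1:] * (\<Prod>e\<leftarrow>es. [:- e, 1:])" using Cons.prems by simp
  have "degree (char_poly A) = Suc (degree (\<Prod>e\<leftarrow>es. [:- e, 1:]))"
    unfolding cp by (subst degree_mult_eq) (use monic in auto)
  then obtain m where n: "n = Suc m"
    using degree_monic_char_poly[OF Cons.prems(1)] by auto
  have "eigenvalue A e"
    unfolding eigenvalue_root_char_poly[OF Cons.prems(1)] cp by simp
  then obtain v where v: "v \<in> carrier_vec n" "v \<noteq> 0\<^sub>v n" and Av: "A *\<^sub>v v = e \<cdot>\<^sub>v v"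
    using Cons.prems(1) by (auto simp: eigenvalue_def eigenvector_def)
  obtain W c where W: "unitary_mat n W" and col0: "col W 0 = c \<cdot>\<^sub>v v" and c0: "c \<noteq> 0"
    using unitary_mat_completion[OF v] by blast
  have cW: "W \<in> carrier_mat n n" "mat_adjoint W \<in> carrier_mat n n" and WW: "mat_adjoint W * W = 1\<^sub>m n"
    using W by (auto simp: unitary_mat_def mat_adjoint_carrier)
  note cA = Cons.prems(1)
  note ass = assoc_mult_mat[of _ n n _ n _ n] mult_carrier_mat[of _ n n _ n]
  define A' where "A' = mat_adjoint W * A * W"
  have cA': "A' \<in> carrier_mat n n" using cW cA by (simp add: A'_def)
  have herm: "mat_adjoint A' = A'"
  proof -
    have "mat_adjoint A' = mat_adjoint W * (mat_adjoint A * W)"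
      unfolding A'_def using mat_adjoint_mult3[OF cW(2) cA cW(1)] by simp
    then show ?thesis unfolding A'_def Cons.prems(2) using cW cA by (simp add: ass)
  qed
  have ccol: "col W 0 \<in> carrier_vec n" unfolding col0 using v by simp
  have "col A' 0 = (mat_adjoint W * A) *\<^sub>v col W 0"
    unfolding A'_def by (rule col_mult2[of _ n n _ n]) (use cW cA n in auto)
  also have "\<dots> = mat_adjoint W *\<^sub>v (A *\<^sub>v col W 0)"
    by (rule assoc_mult_mat_vec[OF cW(2) cA ccol])
  also have "A *\<^sub>v col W 0 = e \<cdot>\<^sub>v col W 0"
    unfolding col0 mult_mat_vec[OF cA v(1)] Av by (simp add: smult_smult_assoc mult.commute)
  also have "mat_adjoint W *\<^sub>v (e \<cdot>\<^sub>v col W 0) = e \<cdot>\<^sub>v (mat_adjoint W *\<^sub>v col W 0)"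
    by (rule mult_mat_vec[OF cW(2) ccol])
  also have "mat_adjoint W *\<^sub>v col W 0 = col (mat_adjoint W * W) 0"
    by (rule col_mult2[symmetric, of _ n n _ n]) (use cW cA n in auto)
  finally have colA': "col A' 0 = e \<cdot>\<^sub>v unit_vec n 0" unfolding WW using n by simp
  have A'0: "A' $$ (i, 0) = (if i = 0 then e else 0)" if "i < n" for i
    using arg_cong[OF colA', of "\<lambda>v. v $ i"] that cA' n by auto
  \<comment> \<open>Hermitian symmetry carries the zeros of the first column over to the first row,
    so \<open>A'\<close> is block diagonal and not merely block triangular.\<close>
  have A'0': "A' $$ (0, i) = (if i = 0 then e else 0)" if "i < n" for i
  proof (cases "i = 0")
    case False
    have "A' $$ (0, i) = mat_adjoint A' $$ (0, i)" unfolding herm ..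
    also have "\<dots> = 0" using A'0[OF that] False that cA' by simp
    finally show ?thesis using False by simp
  qed (use A'0[OF that] in auto)
  define B where "B = mat m m (\<lambda>(i, j). A' $$ (Suc i, Suc j))"
  define E where "E = mat 1 1 (\<lambda>_::nat \<times> nat. e)"
  have cB: "B \<in> carrier_mat m m" and cE: "E \<in> carrier_mat 1 1" by (auto simp: B_def E_def)
  have blk: "A' = four_block_mat E (0\<^sub>m 1 m) (0\<^sub>m m 1) B"
    using cA' n A'0 A'0' by (intro eq_matI) (auto simp: B_def E_def)
  have hermB: "mat_adjoint B = B"
  proof (rule eq_matI)
    fix i j assume "i < dim_row B" "j < dim_col B"
    then have ij: "i < m" "j < m" by (auto simp: B_def)
    have "A' $$ (Suc i, Suc j) = mat_adjoint A' $$ (Suc i, Suc j)" unfolding herm ..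
    also have "\<dots> = cnj (A' $$ (Suc j, Suc i))" using cA' n ij by simp
    finally show "mat_adjoint B $$ (i, j) = B $$ (i, j)" using ij by (simp add: B_def)
  qed (auto simp: B_def)
  have "char_poly A = char_poly A'"
    using similar_mat_unitary[OF W cA'] unitary_mat_conj_cancel(1)[OF W cA]
    unfolding A'_def by (simp add: char_poly_similar)
  also have "\<dots> = char_poly E * char_poly B"
    unfolding blk by (rule char_poly_four_block_zeros_col[OF cE _ cB]) auto
  also have "char_poly E = [:- e, 1:]"
    by (simp add: E_def char_poly_defs det_def sign_def)
  finally have "char_poly B = (\<Prod>e\<leftarrow>es. [:- e, 1:])"
    using cp by (metis mult_cancel_left pCons_eq_0_iff zero_neq_one)
  from Cons.IH[OF cB hermB this] obtain V where V: "unitary_mat m V"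
    and BV: "B = V * mat_diag m (\<lambda>i. es ! i) * mat_adjoint V" by blast
  have cV: "V \<in> carrier_mat m m" "mat_adjoint V \<in> carrier_mat m m" and VV: "mat_adjoint V * V = 1\<^sub>m m"
    using V by (auto simp: unitary_mat_def mat_adjoint_carrier)
  \<comment> \<open>The corner entry 1 leaves the split-off eigenvalue alone; the final unitary is
    \<open>W * V'\<close>.\<close>
  define V' where "V' = four_block_mat (1\<^sub>m 1) (0\<^sub>m 1 m) (0\<^sub>m m 1) V"
  have cV': "V' \<in> carrier_mat n n" 
    using four_block_carrier_mat[OF one_carrier_mat[of 1] cV(1)] n unfolding V'_def by simp
  have adV': "mat_adjoint V' = four_block_mat (1\<^sub>m 1) (0\<^sub>m 1 m) (0\<^sub>m m 1) (mat_adjoint V)"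
  proof -
    have z: "mat_adjoint (0\<^sub>m a b :: complex mat) = 0\<^sub>m b a" for a b by (rule eq_matI) auto
    show ?thesis unfolding V'_def
      by (subst mat_adjoint_four_block[of _ 1 1 _ m _ m]) (use cV in \<open>simp_all add: z\<close>)
  qed
  have UV': "unitary_mat n V'"
  proof -
    have one: "four_block_mat (1\<^sub>m 1) (0\<^sub>m 1 m) (0\<^sub>m m 1) (1\<^sub>m m) = (1\<^sub>m n :: complex mat)"
      using n by (intro eq_matI) auto
    have "mat_adjoint V' * V' = 1\<^sub>m n"
      unfolding adV' unfolding V'_def mult_block_diag[OF one_carrier_mat one_carrier_mat cV(2,1)] VV
      using one by simp
    then show ?thesis using cV' by (simp add: unitary_mat_def)
  qed
  have diag: "mat_diag n (\<lambda>i. (e # es) ! i) = four_block_mat E (0\<^sub>m 1 m) (0\<^sub>m m 1) (mat_diag m (\<lambda>i. es ! i))"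
    using n by (intro eq_matI) (auto simp: mat_diag_def E_def)
  have "V' * mat_diag n (\<lambda>i. (e # es) ! i) * mat_adjoint V' = A'"
  proof -
    have "V' * mat_diag n (\<lambda>i. (e # es) ! i) =
        four_block_mat E (0\<^sub>m 1 m) (0\<^sub>m m 1) (V * mat_diag m (\<lambda>i. es ! i))"
      unfolding diag V'_def mult_block_diag[OF one_carrier_mat cE cV(1) mat_diag_dim]
      using cE by simp
    then show ?thesis
      unfolding adV' blk BV
      using mult_block_diag[OF cE one_carrier_mat mult_carrier_mat[OF cV(1) mat_diag_dim] cV(2)] cE
      by simp
  qed
  then have "A = W * (V' * mat_diag n (\<lambda>i. (e # es) ! i) * mat_adjoint V') * mat_adjoint W"
    using unitary_mat_conj_cancel(1)[OF W cA] by (simp add: A'_def)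
  also have "\<dots> = (W * V') * mat_diag n (\<lambda>i. (e # es) ! i) * mat_adjoint (W * V')"
    unfolding mat_adjoint_mult[OF cW(1) cV'] using cW cV' mat_adjoint_carrier[OF cV']
    by (simp add: ass)
  finally show ?case using unitary_mat_mult[OF W UV'] by blast
qed

lemma quadratic_form_lincomb:
  fixes A :: "complex mat"
  assumes A: "A \<in> carrier_mat n n" and v: "v \<in> carrier_vec n" and w: "w \<in> carrier_vec n"
  shows "(A *\<^sub>v (a \<cdot>\<^sub>v v + c \<cdot>\<^sub>v w)) \<bullet>c (a \<cdot>\<^sub>v v + c \<cdot>\<^sub>v w) =
    a * cnj a * ((A *\<^sub>v v) \<bullet>c v) + a * cnj c * ((A *\<^sub>v v) \<bullet>c w)
    + c * cnj a * ((A *\<^sub>v w) \<bullet>c v) + c * cnj c * ((A *\<^sub>v w) \<bullet>c w)"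
proof -
  have "(A *\<^sub>v (a \<cdot>\<^sub>v v + c \<cdot>\<^sub>v w)) \<bullet>c (a \<cdot>\<^sub>v v + c \<cdot>\<^sub>v w)
      = (a \<cdot>\<^sub>v (A *\<^sub>v v) + c \<cdot>\<^sub>v (A *\<^sub>v w)) \<bullet>c (a \<cdot>\<^sub>v v + c \<cdot>\<^sub>v w)"
    using A v w by (simp add: mult_add_distrib_mat_vec[of _ n n] mult_mat_vec[of _ n n])
  then show ?thesis
    using v w mult_mat_vec_carrier[OF A v] mult_mat_vec_carrier[OF A w] A
    by (simp add: cscalar_prod_sum[of _ n] sum.distrib sum_distrib_left algebra_simps)
qed

text \<open>Polarisation: the form is real at \<open>e i + e j\<close>, which makes the imaginary
  parts of the two mirrored entries opposite, and at \<open>e i + \<i> e j\<close>, which makes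
  their real parts equal.\<close>

lemma psd_hermitian:
  assumes "psd n A"
  shows "mat_adjoint A = A"
proof (rule eq_matI)
  have cA: "A \<in> carrier_mat n n" and pos: "\<And>v. v \<in> carrier_vec n \<Longrightarrow> 0 \<le> (A *\<^sub>v v) \<bullet>c v"
    using assms by (auto simp: psd_def)
  fix i j assume "i < dim_row A" "j < dim_col A"
  then have ij: "i < n" "j < n" using cA by auto
  define f where "f v w = (A *\<^sub>v v) \<bullet>c w" for v w
  have im: "Im (f v v) = 0" if "v \<in> carrier_vec n" for v
    using pos[OF that] by (simp add: f_def less_eq_complex_def)
  have add: "f (1 \<cdot>\<^sub>v v + c \<cdot>\<^sub>v w) (1 \<cdot>\<^sub>v v + c \<cdot>\<^sub>v w) = f v v + cnj c * f v w + c * f w v + c * cnj c * f w w"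
    if "v \<in> carrier_vec n" "w \<in> carrier_vec n" for v w c
    using quadratic_form_lincomb[OF cA that, of 1 c] by (simp add: f_def)
  define e where "e i = (unit_vec n i :: complex vec)" for i
  have e: "e i \<in> carrier_vec n" for i by (simp add: e_def)
  have fe: "f (e a) (e b) = A $$ (b, a)" if "a < n" "b < n" for a b
  proof -
    have "f (e a) (e b) = (\<Sum>l<n. (A *\<^sub>v e a) $ l * cnj (e b $ l))"
      by (simp add: f_def cscalar_prod_sum[OF e])
    also have "\<dots> = (\<Sum>l<n. if l = b then (A *\<^sub>v e a) $ l else 0)"
      using that by (intro sum.cong) (auto simp: e_def)
    also have "\<dots> = A $$ (b, a)"
      using that cA by (simp add: e_def)
    finally show ?thesis .
  qed
  have "Im (f (e i) (e j)) + Im (f (e j) (e i)) = 0"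
    using im[of "1 \<cdot>\<^sub>v e i + 1 \<cdot>\<^sub>v e j"] im[of "e i"] im[of "e j"] e add[of "e i" "e j" 1] by simp
  moreover have "Re (f (e j) (e i)) - Re (f (e i) (e j)) = 0"
    using im[of "1 \<cdot>\<^sub>v e i + \<i> \<cdot>\<^sub>v e j"] im[of "e i"] im[of "e j"] e add[of "e i" "e j" \<i>] by simp
  ultimately have "A $$ (i, j) = cnj (A $$ (j, i))"
    unfolding fe[OF ij] fe[OF ij(2,1)] by (auto simp: complex_eq_iff)
  then show "mat_adjoint A $$ (i, j) = A $$ (i, j)" using ij cA by simp
qed (use assms in \<open>auto simp: psd_def\<close>)

section \<open>Ordered eigenvalues, quadratic forms and a min-max bound\<close>

lemma char_poly_unitary_diag:
  assumes "unitary_mat n U"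
  shows "char_poly (U * mat_diag n f * mat_adjoint U) = (\<Prod>e\<leftarrow>map f [0..<n]. [:- e, 1:])"
proof -
  have "char_poly (U * mat_diag n f * mat_adjoint U) = char_poly (mat_diag n f)"
    by (rule char_poly_similar[OF similar_mat_unitary[OF assms mat_diag_dim]])
  also have "\<dots> = (\<Prod>e\<leftarrow>diag_mat (mat_diag n f). [:- e, 1:])"
    by (rule char_poly_upper_triangular[OF mat_diag_dim]) (auto simp: mat_diag_def upper_triangular_def)
  also have "diag_mat (mat_diag n f) = map f [0..<n]"
    by (auto simp: diag_mat_def mat_diag_def)
  finally show ?thesis .
qed

lemma proots_prod_linear: "proots (\<Prod>e\<leftarrow>es. [:- e, 1:]) = mset (es :: complex list)"
proof (induction es)
  case (Cons e es)
  have "(\<Prod>e\<leftarrow>es. [:- e, 1:]) \<noteq> 0" by (auto simp: prod_list_zero_iff)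
  then show ?case using Cons proots_mult[of "[:- e, 1:]" "\<Prod>e\<leftarrow>es. [:- e, 1:]"] by simp
qed simp

text \<open>The roots of the characteristic polynomial are the diagonal entries; as \<open>r\<close>
  is already non-increasing, sorting and reversing restores it. The shift arises because
  \<open>eig_val\<close> counts from 1 and the diagonal from 0.\<close>

lemma eig_val_unitary_diag:
  assumes U: "unitary_mat n U" and r: "\<And>i j. i \<le> j \<Longrightarrow> j < n \<Longrightarrow> r j \<le> r i" and j: "j < n"
  shows "eig_val (Suc j) (U * mat_diag n (\<lambda>i. complex_of_real (r i)) * mat_adjoint U) = r j"
proof -
  have "sorted (rev (map r [0..<n]))"
    using r by (auto simp: sorted_iff_nth_mono rev_nth)
  then have "rev (sort (map r [0..<n])) = map r [0..<n]"
    by (metis properties_for_sort mset_rev rev_rev_ident)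
  moreover have "image_mset Re (proots (char_poly (U * mat_diag n (\<lambda>i. complex_of_real (r i)) * mat_adjoint U)))
      = mset (map r [0..<n])"
    unfolding char_poly_unitary_diag[OF U] proots_prod_linear by (simp add: multiset.map_comp o_def)
  ultimately have "eig_val (Suc j) (U * mat_diag n (\<lambda>i. complex_of_real (r i)) * mat_adjoint U)
      = map r [0..<n] ! j"
    by (simp only: eig_val_def sorted_list_of_multiset_mset diff_Suc_1)
  then show ?thesis using j by simp
qed

text \<open>Diagonalisation is used twice: first with the roots in arbitrary order, to see that they
  are real because the diagonal form is again Hermitian, then with the same roots listed in
  decreasing order.\<close>

lemma hermitian_eig_decomp:
  fixes A :: "complex mat"
  assumes A: "A \<in> carrier_mat n n" "mat_adjoint A = A"
  obtains U r where "unitary_mat n U" "A = U * mat_diag n (\<lambda>i. complex_of_real (r i)) * mat_adjoint U"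
    "\<And>i j. i \<le> j \<Longrightarrow> j < n \<Longrightarrow> r j \<le> r i" "\<And>j. j < n \<Longrightarrow> eig_val (Suc j) A = r j"
proof -
  obtain es where es: "char_poly A = (\<Prod>e\<leftarrow>es. [:- e, 1:])" "length es = n"
    using char_poly_factorized[OF A(1)] by blast
  obtain U where U: "unitary_mat n U" and AU: "A = U * mat_diag n (\<lambda>i. es ! i) * mat_adjoint U"
    using hermitian_unitary_diag[OF A es(1)] by blast
  have cU: "U \<in> carrier_mat n n" "mat_adjoint U \<in> carrier_mat n n"
    using U by (auto simp: unitary_mat_def mat_adjoint_carrier)
  have D: "mat_diag n (\<lambda>i. es ! i) = mat_adjoint U * A * U"
    unfolding AU by (rule unitary_mat_conj_cancel(2)[OF U mat_diag_dim, symmetric])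
  have "mat_adjoint (mat_adjoint U * A * U) = mat_adjoint U * A * U"
    unfolding mat_adjoint_mult3[OF cU(2) A(1) cU(1)] A(2) using cU A(1) by simp
  then have D2: "mat_diag n (\<lambda>i. cnj (es ! i)) = mat_diag n (\<lambda>i. es ! i)"
    unfolding D[symmetric] mat_adjoint_diag .
  have "es ! i = complex_of_real (Re (es ! i))" if "i < n" for i
    using arg_cong[OF D2, of "\<lambda>M. M $$ (i, i)"] that by (simp add: mat_diag_def complex_eq_iff)
  then have es_real: "map (\<lambda>e. complex_of_real (Re e)) es = es"
    using es(2) by (intro nth_equalityI) auto
  define rs where "rs = rev (sort (map Re es))"
  have "mset (map complex_of_real rs) = mset (map (\<lambda>e. complex_of_real (Re e)) es)"
    by (simp add: rs_def multiset.map_comp o_def)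
  then have ms: "mset (map complex_of_real rs) = mset es" by (simp only: es_real)
  have "char_poly A = prod_mset (image_mset (\<lambda>e. [:- e, 1:]) (mset es))"
    unfolding es(1) by (metis mset_map prod_mset_prod_list)
  also have "\<dots> = (\<Prod>e\<leftarrow>map complex_of_real rs. [:- e, 1:])"
    unfolding ms[symmetric] by (metis mset_map prod_mset_prod_list)
  finally obtain V where V: "unitary_mat n V"
    and AV: "A = V * mat_diag n (\<lambda>i. map complex_of_real rs ! i) * mat_adjoint V"
    using hermitian_unitary_diag[OF A] by blast
  have len: "length rs = n" by (simp add: rs_def es(2))
  have "mat_diag n (\<lambda>i. map complex_of_real rs ! i) = mat_diag n (\<lambda>i. complex_of_real (rs ! i))"
    using len by (intro eq_matI) (auto simp: mat_diag_def)
  with AV have AV': "A = V * mat_diag n (\<lambda>i. complex_of_real (rs ! i)) * mat_adjoint V" by simp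
  have dec: "rs ! j \<le> rs ! i" if "i \<le> j" "j < n" for i j
  proof -
    have "sorted (rev rs)" by (simp add: rs_def)
    then show ?thesis using that len unfolding sorted_rev_iff_nth_mono by blast
  qed
  show thesis
    by (rule that[OF V AV' dec]) (auto simp: AV' intro: eig_val_unitary_diag[OF V dec])
qed

lemma unitary_diag_quadratic:
  assumes U: "unitary_mat n U" and v: "v \<in> carrier_vec n"
  shows "Re ((U * mat_diag n (\<lambda>i. complex_of_real (r i)) * mat_adjoint U *\<^sub>v v) \<bullet>c v)
    = (\<Sum>i<n. r i * (cmod ((mat_adjoint U *\<^sub>v v) $ i))\<^sup>2)"
    and "Re (v \<bullet>c v) = (\<Sum>i<n. (cmod ((mat_adjoint U *\<^sub>v v) $ i))\<^sup>2)"
proof -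
  have cU: "U \<in> carrier_mat n n" "mat_adjoint U \<in> carrier_mat n n"
    using U by (auto simp: unitary_mat_def mat_adjoint_carrier)
  define y where "y = mat_adjoint U *\<^sub>v v"
  have y: "y \<in> carrier_vec n" using cU v by (simp add: y_def)
  define D where "D r = mat_diag n (\<lambda>i. complex_of_real (r i))" for r :: "nat \<Rightarrow> real"
  have cD: "D r \<in> carrier_mat n n" for r by (simp add: D_def)
  have Dy: "(D r *\<^sub>v y) $ i = r i * y $ i" if "i < n" for i r
  proof -
    have "(D r *\<^sub>v y) $ i = (\<Sum>l<n. (if i = l then complex_of_real (r l) else 0) * y $ l)"
      using that y by (simp add: D_def mat_diag_def scalar_prod_def atLeast0LessThan)
    also have "\<dots> = (\<Sum>l<n. if l = i then r i * y $ i else 0)"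
      by (intro sum.cong) auto
    finally have "(D r *\<^sub>v y) $ i = (\<Sum>l<n. if l = i then r i * y $ i else 0)" .
    then show ?thesis using that by simp
  qed
  have *: "Re ((U * D r * mat_adjoint U *\<^sub>v v) \<bullet>c v) = (\<Sum>i<n. r i * (cmod (y $ i))\<^sup>2)" for r
  proof -
    have "U * D r * mat_adjoint U *\<^sub>v v = (U * D r) *\<^sub>v y"
      unfolding y_def by (rule assoc_mult_mat_vec[OF mult_carrier_mat[OF cU(1) cD] cU(2) v])
    also have "\<dots> = U *\<^sub>v (D r *\<^sub>v y)"
      by (rule assoc_mult_mat_vec[OF cU(1) cD y])
    finally have "(U * D r * mat_adjoint U *\<^sub>v v) \<bullet>c v = (D r *\<^sub>v y) \<bullet>c y"
      using cscalar_prod_adjoint[OF cU(1) mult_mat_vec_carrier[OF cD y] v] by (simp add: y_def)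
    also have "\<dots> = (\<Sum>i<n. complex_of_real (r i * (cmod (y $ i))\<^sup>2))"
      unfolding cscalar_prod_sum[OF y]
      by (rule sum.cong) (auto simp: Dy complex_norm_square simp del: of_real_power)
    finally show ?thesis by simp
  qed
  show "Re ((U * mat_diag n (\<lambda>i. complex_of_real (r i)) * mat_adjoint U *\<^sub>v v) \<bullet>c v)
    = (\<Sum>i<n. r i * (cmod ((mat_adjoint U *\<^sub>v v) $ i))\<^sup>2)"
    using *[of r] by (simp add: D_def y_def)
  \<comment> \<open>Constant weight 1 turns the formula into Parseval's identity.\<close>
  have "U * D (\<lambda>_. 1) * mat_adjoint U = 1\<^sub>m n"
    using cU unitary_mat_right_inverse[OF U] by (simp add: D_def)
  then show "Re (v \<bullet>c v) = (\<Sum>i<n. (cmod ((mat_adjoint U *\<^sub>v v) $ i))\<^sup>2)"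
    using *[of "\<lambda>_. 1"] v by (simp add: y_def)
qed

text \<open>The lower half of Courant--Fischer. The test space is the image under \<open>Q\<close>
  of the vectors supported on the first \<open>j + 1\<close> coordinates; by dimension it contains a
  nonzero vector orthogonal to the top \<open>j\<close> eigenvectors of \<open>H\<close>.\<close>

lemma eig_val_ge:
  fixes H Q :: "complex mat"
  assumes H: "H \<in> carrier_mat d d" "mat_adjoint H = H" and Q: "Q \<in> carrier_mat d k"
    and j: "j < k" "j < d"
    and low: "\<And>v. v \<in> carrier_vec k \<Longrightarrow> v \<noteq> 0\<^sub>v k \<Longrightarrow> (\<And>i. j < i \<Longrightarrow> i < k \<Longrightarrow> v $ i = 0) \<Longrightarrow>
      Q *\<^sub>v v \<noteq> 0\<^sub>v d \<and> c * Re ((Q *\<^sub>v v) \<bullet>c (Q *\<^sub>v v)) \<le> Re ((H *\<^sub>v (Q *\<^sub>v v)) \<bullet>c (Q *\<^sub>v v))"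
  shows "c \<le> eig_val (Suc j) H"
proof -
  obtain U r where U: "unitary_mat d U" and HU: "H = U * mat_diag d (\<lambda>i. complex_of_real (r i)) * mat_adjoint U"
    and dec: "\<And>i j. i \<le> j \<Longrightarrow> j < d \<Longrightarrow> r j \<le> r i" and ev: "\<And>j. j < d \<Longrightarrow> eig_val (Suc j) H = r j"
    using hermitian_eig_decomp[OF H] by blast
  have cU: "mat_adjoint U \<in> carrier_mat d d"
    using U by (auto simp: unitary_mat_def mat_adjoint_carrier)
  define R where "R = mat_adjoint U * Q"
  have cR: "R \<in> carrier_mat d k" using cU Q by (simp add: R_def)
  \<comment> \<open>One square system collects all the constraints on \<open>v\<close>: rows
    \<open>i < j\<close> ask that \<open>Q v\<close> be orthogonal to the top \<open>j\<close>
    eigenvectors, rows \<open>i > j\<close> ask that \<open>v $ i = 0\<close>. The zero row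
    \<open>j\<close> makes the system singular, which supplies a nonzero solution.\<close>
  define M where "M = mat k k (\<lambda>(i, l). if i < j then R $$ (i, l) else if i = j then 0 else if i = l then 1 else 0)"
  have cM: "M \<in> carrier_mat k k" by (simp add: M_def)
  have "det (transpose_mat M) = 0"
  proof -
    have "transpose_mat M *\<^sub>v unit_vec k j = 0\<^sub>v k"
      using j cM by (intro eq_vecI) (auto simp: M_def)
    moreover have "unit_vec k j \<noteq> (0\<^sub>v k :: complex vec)" using j by simp
    ultimately show ?thesis
      using det_0_iff_vec_prod_zero[of "transpose_mat M" k] cM unit_vec_carrier by fastforce
  qed
  then have "det M = 0" using det_transpose[OF cM] by simp
  then obtain v where v: "v \<in> carrier_vec k" "v \<noteq> 0\<^sub>v k" and Mv: "M *\<^sub>v v = 0\<^sub>v k"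
    using det_0_iff_vec_prod_zero[OF cM] by blast
  have sc: "(\<Sum>l<k. M $$ (i, l) * v $ l) = 0" if "i < k" for i
    using arg_cong[OF Mv, of "\<lambda>x. x $ i"] that cM v by (simp add: scalar_prod_def atLeast0LessThan)
  have supp: "v $ i = 0" if "j < i" "i < k" for i
  proof -
    have "(\<Sum>l<k. M $$ (i, l) * v $ l) = (\<Sum>l<k. if l = i then v $ i else 0)"
      using that by (intro sum.cong) (auto simp: M_def)
    then show ?thesis using sc[OF that(2)] that by simp
  qed
  define w where "w = Q *\<^sub>v v"
  have w: "w \<in> carrier_vec d" using Q v by (simp add: w_def)
  have w': "w \<noteq> 0\<^sub>v d" "c * Re (w \<bullet>c w) \<le> Re ((H *\<^sub>v w) \<bullet>c w)"
    using low[OF v supp] by (auto simp: w_def)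
  define y where "y = mat_adjoint U *\<^sub>v w"
  have "y = R *\<^sub>v v" unfolding y_def w_def R_def using assoc_mult_mat_vec[OF cU Q v(1)] by simp
  have y0: "y $ i = 0" if "i < j" for i
  proof -
    have "y $ i = (\<Sum>l<k. M $$ (i, l) * v $ l)"
      using that j cR v unfolding \<open>y = R *\<^sub>v v\<close>
      by (auto simp: scalar_prod_def atLeast0LessThan M_def intro!: sum.cong)
    then show ?thesis using sc[of i] that j by simp
  qed
  have "Re ((H *\<^sub>v w) \<bullet>c w) = (\<Sum>i<d. r i * (cmod (y $ i))\<^sup>2)"
    unfolding HU y_def by (rule unitary_diag_quadratic(1)[OF U w])
  \<comment> \<open>Only the coordinates \<open>i \<ge> j\<close> of \<open>y\<close> survive, and
    there \<open>r i \<le> r j\<close>.\<close>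
  also have "\<dots> \<le> (\<Sum>i<d. r j * (cmod (y $ i))\<^sup>2)"
  proof (rule sum_mono)
    fix i assume "i \<in> {..<d}"
    then show "r i * (cmod (y $ i))\<^sup>2 \<le> r j * (cmod (y $ i))\<^sup>2"
      using y0[of i] dec[of j i] by (cases "i < j") (auto intro: mult_right_mono)
  qed
  also have "\<dots> = r j * Re (w \<bullet>c w)"
    unfolding unitary_diag_quadratic(2)[OF U w] y_def by (simp add: sum_distrib_left)
  finally have "c * Re (w \<bullet>c w) \<le> r j * Re (w \<bullet>c w)" using w'(2) by simp
  then show ?thesis using Re_cscalar_prod_self(3)[OF w w'(1)] ev[OF j(2)] by simp
qed

subsection \<open>Cauchy--Schwarz and Chebyshev inequalities for positive maps\<close>

lemma cscalar_prod_cnj: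
  fixes v w :: "complex vec"
  assumes "v \<in> carrier_vec n" "w \<in> carrier_vec n"
  shows "w \<bullet>c v = cnj (v \<bullet>c w)"
  unfolding cscalar_prod_sum[OF assms(1)] cscalar_prod_sum[OF assms(2)] by (simp add: mult.commute)

lemma hermitian_cscalar_prod:
  fixes A :: "complex mat"
  assumes "A \<in> carrier_mat n n" "mat_adjoint A = A" "v \<in> carrier_vec n" "w \<in> carrier_vec n"
  shows "(A *\<^sub>v v) \<bullet>c w = v \<bullet>c (A *\<^sub>v w)"
  using cscalar_prod_adjoint[OF assms(1,3,4)] assms(2) by simp

lemma psdI:
  assumes A: "A \<in> carrier_mat n n" "mat_adjoint A = A"
    and pos: "\<And>v. v \<in> carrier_vec n \<Longrightarrow> 0 \<le> Re ((A *\<^sub>v v) \<bullet>c v)"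
  shows "psd n A"
  unfolding psd_def
proof (intro conjI ballI A(1))
  fix v :: "complex vec" assume v: "v \<in> carrier_vec n"
  have "(A *\<^sub>v v) \<bullet>c v = cnj ((A *\<^sub>v v) \<bullet>c v)"
    using hermitian_cscalar_prod[OF A v v] cscalar_prod_cnj[OF mult_mat_vec_carrier[OF A(1) v] v] by simp
  then have "Im ((A *\<^sub>v v) \<bullet>c v) = 0"
    by (metis cnj.sel(2) neg_equal_zero)
  then show "0 \<le> (A *\<^sub>v v) \<bullet>c v" using pos[OF v] by (simp add: less_eq_complex_def)
qed

lemma psd_Re_nonneg: "psd n A \<Longrightarrow> v \<in> carrier_vec n \<Longrightarrow> 0 \<le> Re ((A *\<^sub>v v) \<bullet>c v)"
  by (auto simp: psd_def less_eq_complex_def)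

lemma hermitian_quadratic_lincomb:
  fixes A :: "complex mat" and a c :: real
  assumes A: "A \<in> carrier_mat n n" "mat_adjoint A = A" and v: "v \<in> carrier_vec n" and w: "w \<in> carrier_vec n"
  defines "u \<equiv> complex_of_real a \<cdot>\<^sub>v v + complex_of_real c \<cdot>\<^sub>v w"
  shows "Re ((A *\<^sub>v u) \<bullet>c u) =
    a\<^sup>2 * Re ((A *\<^sub>v v) \<bullet>c v) + 2 * a * c * Re ((A *\<^sub>v v) \<bullet>c w) + c\<^sup>2 * Re ((A *\<^sub>v w) \<bullet>c w)"
proof -
  have "(A *\<^sub>v w) \<bullet>c v = cnj ((A *\<^sub>v v) \<bullet>c w)"
    using hermitian_cscalar_prod[OF A w v] cscalar_prod_cnj[OF mult_mat_vec_carrier[OF A(1) v] w] by simp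
  then have "Re ((A *\<^sub>v w) \<bullet>c v) = Re ((A *\<^sub>v v) \<bullet>c w)" by simp
  then show ?thesis
    unfolding u_def quadratic_form_lincomb[OF A(1) v w] by (simp add: power2_eq_square)
qed

lemma discriminant_le:
  fixes P Q S :: real
  assumes "\<And>t. 0 \<le> P + 2 * t * S + t\<^sup>2 * Q" "0 \<le> Q"
  shows "S\<^sup>2 \<le> P * Q"
proof (cases "Q = 0")
  case True
  have "S = 0"
  proof (rule ccontr)
    assume "S \<noteq> 0"
    \<comment> \<open>With no quadratic term the polynomial is linear in \<open>t\<close>; this
      \<open>t\<close> makes its value -1.\<close>
    then have "2 * (- (P + 1) / (2 * S)) * S = - (P + 1)" by simp
    with assms(1)[of "- (P + 1) / (2 * S)"] True show False by simp
  qed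
  then show ?thesis using True by simp
next
  case False
  then have "0 < Q" using assms(2) by simp
  moreover have "P + 2 * (- S / Q) * S + (- S / Q)\<^sup>2 * Q = P - S\<^sup>2 / Q"
    using False by (simp add: power2_eq_square field_simps)
  ultimately show ?thesis using assms(1)[of "- S / Q"] by (simp only: diff_ge_0_iff_ge pos_divide_le_eq)
qed

text \<open>Summing the forms of the \<open>E i\<close> gives a semi-inner product on
  \<open>n\<close>-tuples of vectors; this is its Cauchy--Schwarz inequality (in real parts) for the
  tuples \<open>\<alpha> i w\<close> and \<open>\<beta> i z\<close>.\<close>

lemma psd_family_cauchy_schwarz:
  fixes E :: "nat \<Rightarrow> complex mat"
  assumes E: "\<forall>i<n. psd d (E i)" and w: "w \<in> carrier_vec d" and z: "z \<in> carrier_vec d"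
  shows "(\<Sum>i<n. \<alpha> i * \<beta> i * Re ((E i *\<^sub>v w) \<bullet>c z))\<^sup>2
    \<le> (\<Sum>i<n. (\<alpha> i)\<^sup>2 * Re ((E i *\<^sub>v w) \<bullet>c w)) * (\<Sum>i<n. (\<beta> i)\<^sup>2 * Re ((E i *\<^sub>v z) \<bullet>c z))"
proof (rule discriminant_le)
  fix t :: real
  let ?u = "\<lambda>i. complex_of_real (\<alpha> i) \<cdot>\<^sub>v w + complex_of_real (t * \<beta> i) \<cdot>\<^sub>v z"
  have "0 \<le> (\<Sum>i<n. Re ((E i *\<^sub>v ?u i) \<bullet>c ?u i))"
    using w z E by (intro sum_nonneg psd_Re_nonneg[of d]) auto
  also have "\<dots> = (\<Sum>i<n. (\<alpha> i)\<^sup>2 * Re ((E i *\<^sub>v w) \<bullet>c w)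
      + 2 * t * (\<alpha> i * \<beta> i * Re ((E i *\<^sub>v w) \<bullet>c z)) + t\<^sup>2 * ((\<beta> i)\<^sup>2 * Re ((E i *\<^sub>v z) \<bullet>c z)))"
  proof (rule sum.cong)
    fix i assume "i \<in> {..<n}"
    then have i: "E i \<in> carrier_mat d d" "mat_adjoint (E i) = E i"
      using E psd_hermitian[of d "E i"] by (auto simp: psd_def)
    show "Re ((E i *\<^sub>v ?u i) \<bullet>c ?u i) = (\<alpha> i)\<^sup>2 * Re ((E i *\<^sub>v w) \<bullet>c w)
      + 2 * t * (\<alpha> i * \<beta> i * Re ((E i *\<^sub>v w) \<bullet>c z)) + t\<^sup>2 * ((\<beta> i)\<^sup>2 * Re ((E i *\<^sub>v z) \<bullet>c z))"
      unfolding hermitian_quadratic_lincomb[OF i w z] by (simp add: power_mult_distrib)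
  qed simp
  finally show "0 \<le> (\<Sum>i<n. (\<alpha> i)\<^sup>2 * Re ((E i *\<^sub>v w) \<bullet>c w))
      + 2 * t * (\<Sum>i<n. \<alpha> i * \<beta> i * Re ((E i *\<^sub>v w) \<bullet>c z))
      + t\<^sup>2 * (\<Sum>i<n. (\<beta> i)\<^sup>2 * Re ((E i *\<^sub>v z) \<bullet>c z))"
    by (simp only: sum.distrib sum_distrib_left)
next
  show "0 \<le> (\<Sum>i<n. (\<beta> i)\<^sup>2 * Re ((E i *\<^sub>v z) \<bullet>c z))"
    using z E by (intro sum_nonneg mult_nonneg_nonneg psd_Re_nonneg[of d]) auto
qed

text \<open>The double sum of \<open>p i * p j * ((x i - x j) * (y i - y j))\<close> is non-negative
  and expands to twice the difference of the two sides.\<close>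

lemma weighted_chebyshev:
  fixes p x y :: "nat \<Rightarrow> real"
  assumes p: "\<And>i. i < n \<Longrightarrow> 0 \<le> p i"
    and mono: "\<And>i j. i < n \<Longrightarrow> j < n \<Longrightarrow> 0 \<le> (x i - x j) * (y i - y j)"
  shows "(\<Sum>i<n. x i * p i) * (\<Sum>i<n. y i * p i) \<le> (\<Sum>i<n. x i * y i * p i) * (\<Sum>i<n. p i)"
proof -
  have "0 \<le> (\<Sum>i<n. \<Sum>j<n. p i * p j * ((x i - x j) * (y i - y j)))"
    by (intro sum_nonneg mult_nonneg_nonneg[OF mult_nonneg_nonneg]) (use p mono in auto)
  also have "\<dots> = (\<Sum>i<n. \<Sum>j<n. (x i * y i * p i) * p j - (x i * p i) * (y j * p j)
      - (y i * p i) * (x j * p j) + p i * (x j * y j * p j))"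
    by (intro sum.cong) (auto simp: algebra_simps)
  also have "\<dots> = 2 * ((\<Sum>i<n. x i * y i * p i) * (\<Sum>i<n. p i) - (\<Sum>i<n. x i * p i) * (\<Sum>i<n. y i * p i))"
    by (simp add: sum.distrib sum_subtractf flip: sum_product)
  finally show ?thesis by simp
qed

lemma congruence_form:
  fixes H Q :: "complex mat"
  assumes "H \<in> carrier_mat d d" "Q \<in> carrier_mat d k" "v \<in> carrier_vec k"
  shows "((mat_adjoint Q * H * Q) *\<^sub>v v) \<bullet>c v = (H *\<^sub>v (Q *\<^sub>v v)) \<bullet>c (Q *\<^sub>v v)"
proof -
  note cQ = mat_adjoint_carrier[OF assms(2)]
  have Qv: "Q *\<^sub>v v \<in> carrier_vec d" using assms by simp
  have HQv: "H *\<^sub>v (Q *\<^sub>v v) \<in> carrier_vec d" using assms by simp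
  have "(mat_adjoint Q * H * Q) *\<^sub>v v = mat_adjoint Q *\<^sub>v (H *\<^sub>v (Q *\<^sub>v v))"
    using assoc_mult_mat_vec[OF mult_carrier_mat[OF cQ assms(1)] assms(2,3)]
      assoc_mult_mat_vec[OF cQ assms(1) Qv] by simp
  then show ?thesis using cscalar_prod_adjoint[OF cQ HQv assms(3)] by simp
qed

lemma adjoint_mult_self_form:
  fixes Q :: "complex mat"
  assumes "Q \<in> carrier_mat d k" "v \<in> carrier_vec k"
  shows "((mat_adjoint Q * Q) *\<^sub>v v) \<bullet>c v = (Q *\<^sub>v v) \<bullet>c (Q *\<^sub>v v)"
  using congruence_form[OF one_carrier_mat assms] assms mat_adjoint_carrier[OF assms(1)] by simp

text \<open>
  A positive unital map restricted to the commutative algebra of diagonal matrices, given by the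
  images \<open>E i\<close> of the rank-one diagonal projections.
\<close>

locale positive_diagonal_map =
  fixes n d :: nat and F :: "(nat \<Rightarrow> real) \<Rightarrow> complex mat" and E :: "nat \<Rightarrow> complex mat"
  assumes psd_E: "\<forall>i<n. psd d (E i)"
    and psd_F: "\<And>x. \<forall>i<n. 0 \<le> x i \<Longrightarrow> psd d (F x)"
    and F_form: "\<And>x v w. v \<in> carrier_vec d \<Longrightarrow> w \<in> carrier_vec d \<Longrightarrow>
      Re ((F x *\<^sub>v v) \<bullet>c w) = (\<Sum>i<n. x i * Re ((E i *\<^sub>v v) \<bullet>c w))"
    and F_one: "F (\<lambda>_. 1) = 1\<^sub>m d"
begin

lemma F_carrier: "\<forall>i<n. 0 \<le> x i \<Longrightarrow> F x \<in> carrier_mat d d"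
  using psd_F by (auto simp: psd_def)

lemma F_hermitian: "\<forall>i<n. 0 \<le> x i \<Longrightarrow> mat_adjoint (F x) = F x"
  using psd_F psd_hermitian by blast

lemma F_sym:
  assumes "\<forall>i<n. 0 \<le> x i" "v \<in> carrier_vec d" "w \<in> carrier_vec d"
  shows "(F x *\<^sub>v v) \<bullet>c w = v \<bullet>c (F x *\<^sub>v w)"
  using hermitian_cscalar_prod[OF F_carrier F_hermitian] assms by blast

lemma inner_eq_sum:
  assumes "v \<in> carrier_vec d" "w \<in> carrier_vec d"
  shows "Re (v \<bullet>c w) = (\<Sum>i<n. Re ((E i *\<^sub>v v) \<bullet>c w))"
  using F_form[OF assms, of "\<lambda>_. 1"] assms by (simp add: F_one)

text \<open>An inverse-free form of \<open>X N^{-1} X \<le> G\<close>, with \<open>X\<close>,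
  \<open>N\<close>, \<open>G\<close> the images of \<open>b\<close>, \<open>b / a\<close>,
  \<open>a b\<close>: Cauchy--Schwarz is applied after splitting \<open>b\<close> into the factors
  \<open>sqrt (a b)\<close> and \<open>sqrt (b / a)\<close>.\<close>

lemma form_ratio_bound:
  assumes a: "\<forall>i<n. 0 \<le> a i" and b: "\<forall>i<n. 0 \<le> b i"
    and ab: "\<And>i. i < n \<Longrightarrow> a i = 0 \<Longrightarrow> b i = 0" and z: "z \<in> carrier_vec d"
  defines "w \<equiv> F b *\<^sub>v z"
  shows "(Re (w \<bullet>c w))\<^sup>2 \<le> Re ((F (\<lambda>i. a i * b i) *\<^sub>v w) \<bullet>c w) * Re ((F (\<lambda>i. b i / a i) *\<^sub>v z) \<bullet>c z)"
proof -
  have w: "w \<in> carrier_vec d" unfolding w_def using F_carrier[OF b] z by simp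
  have "Re (w \<bullet>c w) = Re ((F b *\<^sub>v w) \<bullet>c z)"
    unfolding w_def using F_sym[OF b w z] by (simp add: w_def)
  also have "\<dots> = (\<Sum>i<n. b i * Re ((E i *\<^sub>v w) \<bullet>c z))"
    by (rule F_form[OF w z])
  also have "\<dots> = (\<Sum>i<n. sqrt (a i * b i) * sqrt (b i / a i) * Re ((E i *\<^sub>v w) \<bullet>c z))"
  proof (rule sum.cong)
    fix i assume "i \<in> {..<n}"
    then have i: "i < n" by simp
    \<comment> \<open>Where \<open>a i = 0\<close>, the quotient is 0 by convention and
      \<open>b i = 0\<close> by \<open>ab\<close>, so the splitting survives.\<close>
    have "sqrt (a i * b i) * sqrt (b i / a i) = b i"
      using a b ab i
      by (cases "a i = 0") (auto simp: real_sqrt_mult[symmetric] power2_eq_square[symmetric])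
    then show "b i * Re ((E i *\<^sub>v w) \<bullet>c z) = sqrt (a i * b i) * sqrt (b i / a i) * Re ((E i *\<^sub>v w) \<bullet>c z)"
      by simp
  qed simp
  also have "\<dots>\<^sup>2 \<le> (\<Sum>i<n. (sqrt (a i * b i))\<^sup>2 * Re ((E i *\<^sub>v w) \<bullet>c w))
      * (\<Sum>i<n. (sqrt (b i / a i))\<^sup>2 * Re ((E i *\<^sub>v z) \<bullet>c z))"
    by (rule psd_family_cauchy_schwarz[OF psd_E w z])
  also have "(\<Sum>i<n. (sqrt (a i * b i))\<^sup>2 * Re ((E i *\<^sub>v w) \<bullet>c w)) = Re ((F (\<lambda>i. a i * b i) *\<^sub>v w) \<bullet>c w)"
    unfolding F_form[OF w w] using a b by (intro sum.cong) auto
  also have "(\<Sum>i<n. (sqrt (b i / a i))\<^sup>2 * Re ((E i *\<^sub>v z) \<bullet>c z)) = Re ((F (\<lambda>i. b i / a i) *\<^sub>v z) \<bullet>c z)"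
    unfolding F_form[OF z z] using a b by (intro sum.cong) auto
  finally show ?thesis .
qed

text \<open>Give index \<open>i\<close> the mass \<open>p i\<close>, the form of \<open>E i\<close>
  at \<open>w\<close>; the total mass is \<open>s = |w|^2\<close>. Chebyshev for the squares of
  \<open>a\<close> and for \<open>m\<close> gives \<open>A2 * N \<le> G * s\<close>, and two uses of
  Cauchy--Schwarz give \<open>s^2 \<le> A2 * |u|^2\<close>. With \<open>c |u|^2 \<le> N\<close> this
  chains to \<open>c s^2 \<le> G s\<close>.\<close>

lemma form_chebyshev_bound:
  assumes a: "\<forall>i<n. 0 \<le> a i" and m: "\<forall>i<n. 0 \<le> m i"
    and mono: "\<And>i j. i < n \<Longrightarrow> j < n \<Longrightarrow> 0 \<le> (a i - a j) * (m i - m j)"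
    and u: "u \<in> carrier_vec d" and c: "0 \<le> c"
  defines "w \<equiv> F a *\<^sub>v u"
  assumes low: "c * Re (u \<bullet>c u) \<le> Re ((F m *\<^sub>v w) \<bullet>c w)"
  shows "c * Re (w \<bullet>c w) \<le> Re ((F (\<lambda>i. (a i)\<^sup>2 * m i) *\<^sub>v w) \<bullet>c w)"
proof -
  define p where "p i = Re ((E i *\<^sub>v w) \<bullet>c w)" for i
  define G where "G = (\<Sum>i<n. (a i)\<^sup>2 * m i * p i)"
  define A2 where "A2 = (\<Sum>i<n. (a i)\<^sup>2 * p i)"
  define N where "N = (\<Sum>i<n. m i * p i)"
  define s where "s = Re (w \<bullet>c w)"
  define y where "y = F a *\<^sub>v w"
  have w: "w \<in> carrier_vec d" unfolding w_def using F_carrier[OF a] u by simp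
  have y: "y \<in> carrier_vec d" unfolding y_def using F_carrier[OF a] w by simp
  have p: "0 \<le> p i" if "i < n" for i
    unfolding p_def using psd_E that w by (intro psd_Re_nonneg) auto
  have G: "Re ((F (\<lambda>i. (a i)\<^sup>2 * m i) *\<^sub>v w) \<bullet>c w) = G" and N: "Re ((F m *\<^sub>v w) \<bullet>c w) = N"
    unfolding F_form[OF w w] by (simp_all add: G_def N_def p_def)
  have s: "s = (\<Sum>i<n. p i)" unfolding s_def p_def by (rule inner_eq_sum[OF w w])
  have "0 \<le> s" "0 \<le> G" "0 \<le> A2" "0 \<le> N" using p m by (auto simp: s G_def A2_def N_def intro!: sum_nonneg)
  have cheb: "A2 * N \<le> G * s"
    unfolding A2_def N_def G_def s
  proof (rule weighted_chebyshev[OF p])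
    fix i j assume ij: "i < n" "j < n"
    have "0 \<le> (a i + a j) * ((a i - a j) * (m i - m j))"
      by (rule mult_nonneg_nonneg[OF _ mono[OF ij]]) (use a ij in auto)
    then show "0 \<le> ((a i)\<^sup>2 - (a j)\<^sup>2) * (m i - m j)"
      by (simp add: power2_eq_square algebra_simps)
  qed
  \<comment> \<open>Kadison's inequality in the state given by \<open>w\<close>:
    \<open>|F a w|^2\<close> is at most the form at \<open>w\<close> of the image of the squares of
    \<open>a\<close>. It comes from Cauchy--Schwarz between \<open>w\<close> and
    \<open>y = F a w\<close>, after dividing by \<open>|y|^2\<close>.\<close>
  have "(Re (y \<bullet>c y))\<^sup>2 \<le> A2 * Re (y \<bullet>c y)"
    using psd_family_cauchy_schwarz[OF psd_E w y, where \<alpha> = a and \<beta> = "\<lambda>_. 1"] F_form[OF w y, of a]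
    unfolding inner_eq_sum[OF y y] A2_def p_def by (simp add: y_def[symmetric] inner_eq_sum[OF y y])
  then have yA: "Re (y \<bullet>c y) \<le> A2"
    using \<open>0 \<le> A2\<close> Re_cscalar_prod_self(2)[OF y]
    by (cases "Re (y \<bullet>c y) = 0") (auto simp: power2_eq_square)
  \<comment> \<open>As \<open>F a\<close> is Hermitian, moving it from \<open>w\<close> onto
    \<open>u\<close> turns the pairing into \<open><w, w>\<close>.\<close>
  have "Re (y \<bullet>c u) = s"
    unfolding y_def s_def using F_sym[OF a w u] by (simp add: w_def)
  then have "s\<^sup>2 \<le> Re (y \<bullet>c y) * Re (u \<bullet>c u)"
    using psd_family_cauchy_schwarz[OF psd_E y u, where \<alpha> = "\<lambda>_. 1" and \<beta> = "\<lambda>_. 1"]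
      inner_eq_sum[OF y y] inner_eq_sum[OF u u] inner_eq_sum[OF y u] by simp
  also have "\<dots> \<le> A2 * Re (u \<bullet>c u)"
    by (rule mult_right_mono[OF yA Re_cscalar_prod_self(2)[OF u]])
  finally have "c * s\<^sup>2 \<le> A2 * (c * Re (u \<bullet>c u))"
    using c mult_left_mono[of "s\<^sup>2" "A2 * Re (u \<bullet>c u)" c] by (simp add: mult_ac)
  also have "\<dots> \<le> A2 * N"
    using low \<open>0 \<le> A2\<close> unfolding N by (rule mult_left_mono)
  also note cheb
  finally have "c * s * s \<le> G * s" by (simp add: power2_eq_square mult_ac)
  then have "c * s \<le> G" using \<open>0 \<le> s\<close> \<open>0 \<le> G\<close> by (cases "s = 0") auto
  then show ?thesis unfolding G s_def .
qed

end

subsection \<open>Determinants of compressions\<close>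

lemma det_unitary_diag:
  assumes "unitary_mat n U"
  shows "det (U * mat_diag n f * mat_adjoint U) = (\<Prod>i<n. f i)"
proof -
  have "det (U * mat_diag n f * mat_adjoint U) = det (mat_diag n f)"
    by (rule det_similar[OF similar_mat_unitary[OF assms mat_diag_dim]])
  also have "\<dots> = prod_list (diag_mat (mat_diag n f))"
    by (rule det_upper_triangular[OF _ mat_diag_dim]) (auto simp: mat_diag_def upper_triangular_def)
  also have "diag_mat (mat_diag n f) = map f [0..<n]"
    by (auto simp: diag_mat_def mat_diag_def)
  finally show ?thesis by (simp add: prod.distinct_set_conv_list[symmetric] atLeast0LessThan)
qed

lemma unitary_mat_one: "unitary_mat n (1\<^sub>m n)"
  by (simp add: unitary_mat_def)

lemma det_mat_diag: "det (mat_diag n f) = (\<Prod>i<n. f i :: complex)"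
  using det_unitary_diag[OF unitary_mat_one, of n f]
    left_mult_one_mat[OF mat_diag_dim, of n f] right_mult_one_mat[OF mat_diag_dim, of n f] by simp

lemma diag_quadratic:
  assumes "v \<in> carrier_vec n"
  shows "Re ((mat_diag n (\<lambda>i. complex_of_real (r i)) *\<^sub>v v) \<bullet>c v) = (\<Sum>i<n. r i * (cmod (v $ i))\<^sup>2)"
  using unitary_diag_quadratic(1)[OF unitary_mat_one assms, of r] assms
    left_mult_one_mat[OF mat_diag_dim, of n "\<lambda>i. complex_of_real (r i)"]
    right_mult_one_mat[OF mat_diag_dim, of n "\<lambda>i. complex_of_real (r i)"] by simp

lemma Re_cscalar_prod_self_eq: "v \<in> carrier_vec n \<Longrightarrow> Re (v \<bullet>c v) = (\<Sum>i<n. (cmod (v $ i))\<^sup>2)"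
  using unitary_diag_quadratic(2)[OF unitary_mat_one, of v n] by simp

lemma mult_mat_vec_zero:
  fixes A :: "complex mat"
  assumes "A \<in> carrier_mat m n"
  shows "A *\<^sub>v 0\<^sub>v n = 0\<^sub>v m"
  using assms by (intro eq_vecI) (auto simp: scalar_prod_def)

lemma unitary_adjoint_mult_cancel:
  assumes "unitary_mat n U" "v \<in> carrier_vec n"
  shows "mat_adjoint U *\<^sub>v (U *\<^sub>v v) = v" "v \<noteq> 0\<^sub>v n \<Longrightarrow> U *\<^sub>v v \<noteq> 0\<^sub>v n"
proof -
  have c: "U \<in> carrier_mat n n" "mat_adjoint U \<in> carrier_mat n n" "mat_adjoint U * U = 1\<^sub>m n"
    using assms by (auto simp: unitary_mat_def mat_adjoint_carrier)
  show *: "mat_adjoint U *\<^sub>v (U *\<^sub>v v) = v"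
    using assoc_mult_mat_vec[OF c(2,1) assms(2)] c(3) assms(2) by simp
  show "U *\<^sub>v v \<noteq> 0\<^sub>v n" if "v \<noteq> 0\<^sub>v n"
  proof
    assume "U *\<^sub>v v = 0\<^sub>v n"
    then have "v = mat_adjoint U *\<^sub>v 0\<^sub>v n" using * by simp
    also have "mat_adjoint U *\<^sub>v 0\<^sub>v n = 0\<^sub>v n" by (rule mult_mat_vec_zero[OF c(2)])
    finally show False using that by simp
  qed
qed

lemma unitary_diag_quadratic_image:
  assumes U: "unitary_mat n U" and v: "v \<in> carrier_vec n"
  defines "w \<equiv> U *\<^sub>v v"
  shows "Re ((U * mat_diag n (\<lambda>i. complex_of_real (r i)) * mat_adjoint U *\<^sub>v w) \<bullet>c w)
    = (\<Sum>i<n. r i * (cmod (v $ i))\<^sup>2)"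
proof -
  have "w \<in> carrier_vec n" 
    unfolding w_def by (rule mult_mat_vec_carrier[OF _ v]) (use U in \<open>simp add: unitary_mat_def\<close>)
  from unitary_diag_quadratic(1)[OF U this, of r] show ?thesis
    by (simp add: w_def unitary_adjoint_mult_cancel[OF U v])
qed

lemma unitary_diag_eigenvalue_form:
  assumes U: "unitary_mat n U" and j: "j < n"
  obtains w where "w \<in> carrier_vec n" "w \<noteq> 0\<^sub>v n"
    "Re ((U * mat_diag n (\<lambda>i. complex_of_real (r i)) * mat_adjoint U *\<^sub>v w) \<bullet>c w) = r j"
proof (rule that)
  let ?w = "U *\<^sub>v unit_vec n j"
  have "U \<in> carrier_mat n n" using U by (simp add: unitary_mat_def)
  then show "?w \<in> carrier_vec n" by simp
  show "?w \<noteq> 0\<^sub>v n" by (rule unitary_adjoint_mult_cancel(2)[OF U]) (use j in auto)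
  have "(\<Sum>i<n. r i * (cmod (unit_vec n j $ i))\<^sup>2) = (\<Sum>i<n. if i = j then r j else 0)"
    using j by (intro sum.cong) auto
  then show "Re ((U * mat_diag n (\<lambda>i. complex_of_real (r i)) * mat_adjoint U *\<^sub>v ?w) \<bullet>c ?w) = r j"
    using j unfolding unitary_diag_quadratic_image[OF U unit_vec_carrier] by simp
qed

lemma psd_eigenvalues_nonneg:
  assumes "psd n (U * mat_diag n (\<lambda>i. complex_of_real (r i)) * mat_adjoint U)" "unitary_mat n U" "j < n"
  shows "0 \<le> r j"
  using unitary_diag_eigenvalue_form[OF assms(2,3), of r] psd_Re_nonneg[OF assms(1)] by metis

text \<open>Supplies the lower bounds that \<open>eig_val_ge\<close> asks for: every coordinate
  where \<open>v\<close> may be nonzero carries a weight of at least \<open>r j\<close>.\<close>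

lemma dominated_leading_sum:
  fixes r :: "nat \<Rightarrow> real"
  assumes dec: "\<And>i j. i \<le> j \<Longrightarrow> j < k \<Longrightarrow> r j \<le> r i" and j: "j < k"
    and supp: "\<And>i. j < i \<Longrightarrow> i < k \<Longrightarrow> v $ i = 0" and v: "v \<in> carrier_vec k"
  shows "r j * Re (v \<bullet>c v) \<le> (\<Sum>i<k. r i * (cmod (v $ i))\<^sup>2)"
  unfolding Re_cscalar_prod_self_eq[OF v] sum_distrib_left
proof (rule sum_mono)
  fix i assume "i \<in> {..<k}"
  then show "r j * (cmod (v $ i))\<^sup>2 \<le> r i * (cmod (v $ i))\<^sup>2"
    using dec[of i j] j supp[of i] by (cases "i \<le> j") (auto intro: mult_right_mono)
qed

text \<open>\<open>L\<close> is \<open>K^{-1/2} V\<close>, so the congruence by \<open>L\<close>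
  normalises \<open>K\<close> to the identity.\<close>

lemma congruence_to_one:
  assumes V: "unitary_mat k V" and KV: "K = V * mat_diag k (\<lambda>i. complex_of_real (\<kappa> i)) * mat_adjoint V"
    and pos: "\<And>i. i < k \<Longrightarrow> 0 < \<kappa> i"
  defines "L \<equiv> V * mat_diag k (\<lambda>i. complex_of_real (1 / sqrt (\<kappa> i)))"
  shows "L \<in> carrier_mat k k" "mat_adjoint L * K * L = 1\<^sub>m k"
proof -
  let ?g = "\<lambda>i. complex_of_real (1 / sqrt (\<kappa> i))"
  let ?D = "mat_diag k (\<lambda>i. complex_of_real (\<kappa> i))" and ?S = "mat_diag k ?g"
  have cV: "V \<in> carrier_mat k k" "mat_adjoint V \<in> carrier_mat k k" and VV: "mat_adjoint V * V = 1\<^sub>m k"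
    using V by (auto simp: unitary_mat_def mat_adjoint_carrier)
  have cD: "?D \<in> carrier_mat k k" "?S \<in> carrier_mat k k" by auto
  show "L \<in> carrier_mat k k" using cV cD by (simp add: L_def)
  note ass = assoc_mult_mat[of _ k k _ k _ k] mult_carrier_mat[of _ k k _ k]
  have adL: "mat_adjoint L = ?S * mat_adjoint V"
    unfolding L_def mat_adjoint_mult[OF cV(1) cD(2)] by (simp add: mat_adjoint_diag)
  have "mat_adjoint L * K * L = ?S * (mat_adjoint V * (V * ?D * mat_adjoint V) * V) * ?S"
    unfolding adL unfolding L_def KV using cV cD by (simp add: ass del: mat_diag_diag)
  also have "\<dots> = ?S * ?D * ?S"
    unfolding unitary_mat_conj_cancel(2)[OF V cD(1)] ..
  also have "\<dots> = 1\<^sub>m k"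
  proof -
    have "?g i * complex_of_real (\<kappa> i) * ?g i = 1" if "i < k" for i
    proof -
      have "?g i * complex_of_real (\<kappa> i) * ?g i = complex_of_real (\<kappa> i / (sqrt (\<kappa> i))\<^sup>2)"
        by (simp add: power2_eq_square del: real_sqrt_mult_self flip: of_real_mult of_real_divide)
      then show ?thesis using pos[OF that] by simp
    qed
    then show ?thesis
      unfolding mat_diag_diag by (intro eq_matI) (auto simp: mat_diag_def)
  qed
  finally show "mat_adjoint L * K * L = 1\<^sub>m k" .
qed

lemma congruence_hermitian:
  fixes H Q :: "complex mat"
  assumes "H \<in> carrier_mat d d" "Q \<in> carrier_mat d k" "mat_adjoint H = H"
  shows "mat_adjoint Q * H * Q \<in> carrier_mat k k" "mat_adjoint (mat_adjoint Q * H * Q) = mat_adjoint Q * H * Q"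
proof -
  note cQ = mat_adjoint_carrier[OF assms(2)]
  show "mat_adjoint Q * H * Q \<in> carrier_mat k k" using assms cQ by auto
  show "mat_adjoint (mat_adjoint Q * H * Q) = mat_adjoint Q * H * Q"
    unfolding mat_adjoint_mult3[OF cQ assms(1,2)] using assms cQ
    by (simp add: assoc_mult_mat[OF cQ assms(1,2)])
qed

section \<open>Comparison of the compressed determinants\<close>

context positive_diagonal_map
begin

text \<open>With \<open>Z = F a W\<close>, the matrix \<open>D\<close> of the \<open>s i\<close> is
  the compression of \<open>X^2\<close> by \<open>Z\<close>, and \<open>K\<close> is that of
  \<open>N\<close>. Normalising \<open>K\<close> to 1 turns \<open>D\<close> into \<open>P\<close>,
  and \<open>det D = det P * det K\<close>. The eigenvalues of \<open>K\<close> stand for the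
  squared singular values of \<open>N^{1/2} Y\<close>, those of \<open>P\<close> for the squared
  singular values of \<open>X N^{-1/2}\<close>; each is bounded by the corresponding eigenvalue of
  \<open>G\<close>.\<close>

lemma prod_eig_val_bound:
  assumes a: "\<forall>i<n. 0 \<le> a i" and b: "\<forall>i<n. 0 \<le> b i"
    and ab: "\<And>i. i < n \<Longrightarrow> a i = 0 \<Longrightarrow> b i = 0"
    and mono: "\<And>i j. i < n \<Longrightarrow> j < n \<Longrightarrow> 0 \<le> (a i - a j) * (b i / a i - b j / a j)"
    and W: "W \<in> carrier_mat d k" "mat_adjoint W * W = 1\<^sub>m k" and k: "k \<le> d"
    and s: "mat_adjoint (F b * (F a * W)) * (F b * (F a * W)) = mat_diag k (\<lambda>i. complex_of_real (s i))"
    and s_pos: "\<And>i. i < k \<Longrightarrow> 0 < s i"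
  shows "(\<Prod>i<k. s i) \<le> (\<Prod>i<k. eig_val (Suc i) (F (\<lambda>i. a i * b i)))\<^sup>2"
proof -
  define m where "m i = b i / a i" for i
  define X where "X = F b"
  define Y where "Y = F a"
  define N where "N = F m"
  define G where "G = F (\<lambda>i. a i * b i)"
  have m: "\<forall>i<n. 0 \<le> m i" using a b by (auto simp: m_def)
  have g: "\<forall>i<n. 0 \<le> a i * b i" using a b by auto
  have a2m: "(a i)\<^sup>2 * m i = a i * b i" for i by (simp add: m_def power2_eq_square)
  have car: "X \<in> carrier_mat d d" "Y \<in> carrier_mat d d" "N \<in> carrier_mat d d" "G \<in> carrier_mat d d"
    unfolding X_def Y_def N_def G_def by (rule F_carrier, fact)+
  have herm: "mat_adjoint N = N" "mat_adjoint G = G"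
    unfolding N_def G_def by (rule F_hermitian, fact)+
  have G_nonneg: "0 \<le> Re ((G *\<^sub>v v) \<bullet>c v)" if "v \<in> carrier_vec d" for v
    unfolding G_def by (rule psd_Re_nonneg[OF psd_F[OF g] that])
  define Z where "Z = Y * W"
  define D where "D = mat_diag k (\<lambda>i. complex_of_real (s i))"
  have cZ: "Z \<in> carrier_mat d k" and cXZ: "X * Z \<in> carrier_mat d k" and cD: "D \<in> carrier_mat k k"
    using car W by (simp_all add: Z_def D_def)
  have XZ: "mat_adjoint (X * Z) * (X * Z) = D" using s by (simp add: X_def Y_def Z_def D_def)
  have XZv: "(X * Z) *\<^sub>v y = X *\<^sub>v (Z *\<^sub>v y)" if "y \<in> carrier_vec k" for y
    using assoc_mult_mat_vec[OF car(1) cZ that] by simp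
  have formD: "(D *\<^sub>v y) \<bullet>c y = (X *\<^sub>v (Z *\<^sub>v y)) \<bullet>c (X *\<^sub>v (Z *\<^sub>v y))" if "y \<in> carrier_vec k" for y
    using adjoint_mult_self_form[OF cXZ that] by (simp add: XZ XZv[OF that])
  have D_pos: "0 < Re ((D *\<^sub>v y) \<bullet>c y)" if y: "y \<in> carrier_vec k" "y \<noteq> 0\<^sub>v k" for y
  proof -
    obtain i where i: "i < k" "y $ i \<noteq> 0" using y by (auto simp: vec_eq_iff)
    have "0 < s i * (cmod (y $ i))\<^sup>2" using i s_pos by simp
    also have "\<dots> \<le> (\<Sum>i<k. s i * (cmod (y $ i))\<^sup>2)"
      using i s_pos by (intro member_le_sum) (auto intro!: mult_nonneg_nonneg less_imp_le[OF s_pos])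
    finally show ?thesis unfolding D_def diag_quadratic[OF y(1)] .
  qed
  define K where "K = mat_adjoint Z * N * Z"
  note K = congruence_hermitian[OF car(3) cZ herm(1), folded K_def]
  have formK: "(K *\<^sub>v y) \<bullet>c y = (N *\<^sub>v (Z *\<^sub>v y)) \<bullet>c (Z *\<^sub>v y)" if "y \<in> carrier_vec k" for y
    unfolding K_def by (rule congruence_form[OF car(3) cZ that])
  have ratio: "(Re ((D *\<^sub>v y) \<bullet>c y))\<^sup>2 \<le> Re ((G *\<^sub>v (X *\<^sub>v (Z *\<^sub>v y))) \<bullet>c (X *\<^sub>v (Z *\<^sub>v y))) * Re ((K *\<^sub>v y) \<bullet>c y)"
    if y: "y \<in> carrier_vec k" for y
    using form_ratio_bound[OF a b ab, of "Z *\<^sub>v y"] y cZ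
    unfolding formD[OF y] formK[OF y] X_def G_def N_def m_def by simp
  obtain V \<kappa> where V: "unitary_mat k V"
    and KV: "K = V * mat_diag k (\<lambda>i. complex_of_real (\<kappa> i)) * mat_adjoint V"
    and \<kappa>_dec: "\<And>i j. i \<le> j \<Longrightarrow> j < k \<Longrightarrow> \<kappa> j \<le> \<kappa> i"
    using hermitian_eig_decomp[OF K] by blast
  have cV: "V \<in> carrier_mat k k" using V by (simp add: unitary_mat_def)
  \<comment> \<open>\<open>K\<close> is definite even if \<open>N\<close> is singular: where the
    form of \<open>K\<close> is not positive, \<open>ratio\<close> would force the form of
    \<open>D\<close> to vanish.\<close>
  have \<kappa>_pos: "0 < \<kappa> j" if "j < k" for j
  proof (rule ccontr)
    assume neg: "\<not> 0 < \<kappa> j"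
    obtain y where y: "y \<in> carrier_vec k" "y \<noteq> 0\<^sub>v k" "Re ((K *\<^sub>v y) \<bullet>c y) = \<kappa> j"
      using unitary_diag_eigenvalue_form[OF V \<open>j < k\<close>, of \<kappa>] unfolding KV by blast
    have "X *\<^sub>v (Z *\<^sub>v y) \<in> carrier_vec d" using car cZ y by simp
    then have "Re ((G *\<^sub>v (X *\<^sub>v (Z *\<^sub>v y))) \<bullet>c (X *\<^sub>v (Z *\<^sub>v y))) * Re ((K *\<^sub>v y) \<bullet>c y) \<le> 0"
      using G_nonneg neg y(3) by (intro mult_nonneg_nonpos) auto
    moreover have "0 < (Re ((D *\<^sub>v y) \<bullet>c y))\<^sup>2" using D_pos[OF y(1,2)] by simp
    ultimately show False using ratio[OF y(1)] by linarith
  qed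
  \<comment> \<open>The test vectors are \<open>Z y\<close> with \<open>y\<close> in the span of the
    leading eigenvectors of \<open>K\<close>. Since \<open>W\<close> and \<open>V\<close> preserve
    lengths, the form of \<open>K\<close> at \<open>y\<close> is at least
    \<open>\<kappa> j * |u|^2\<close> for \<open>u = W y\<close>, which is the hypothesis of
    \<open>form_chebyshev_bound\<close> with \<open>c = \<kappa> j\<close>.\<close>
  have \<kappa>_le: "\<kappa> j \<le> eig_val (Suc j) G" if j: "j < k" for j
  proof (rule eig_val_ge[OF car(4) herm(2) mult_carrier_mat[OF cZ cV] j])
    show "j < d" using j k by simp
    fix v :: "complex vec"
    assume v: "v \<in> carrier_vec k" "v \<noteq> 0\<^sub>v k" and supp: "\<And>i. j < i \<Longrightarrow> i < k \<Longrightarrow> v $ i = 0"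
    define y where "y = V *\<^sub>v v"
    have y: "y \<in> carrier_vec k" "y \<noteq> 0\<^sub>v k"
      using cV v unitary_adjoint_mult_cancel(2)[OF V v] by (auto simp: y_def)
    have Qv: "(Z * V) *\<^sub>v v = Z *\<^sub>v y" using assoc_mult_mat_vec[OF cZ cV v(1)] by (simp add: y_def)
    have "Z *\<^sub>v y \<noteq> 0\<^sub>v d"
    proof
      assume "Z *\<^sub>v y = 0\<^sub>v d"
      then have "Re ((D *\<^sub>v y) \<bullet>c y) = 0" unfolding formD[OF y(1)] by (simp add: mult_mat_vec_zero[OF car(1)])
      then show False using D_pos[OF y] by simp
    qed
    moreover have "\<kappa> j * Re ((Z *\<^sub>v y) \<bullet>c (Z *\<^sub>v y)) \<le> Re ((G *\<^sub>v (Z *\<^sub>v y)) \<bullet>c (Z *\<^sub>v y))"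
    proof -
      define u where "u = W *\<^sub>v y"
      have u: "u \<in> carrier_vec d" using W y by (simp add: u_def)
      have Zy: "Z *\<^sub>v y = F a *\<^sub>v u" unfolding Z_def u_def Y_def[symmetric]
        using assoc_mult_mat_vec[OF car(2) W(1) y(1)] .
      have "u \<bullet>c u = y \<bullet>c y"
        using adjoint_mult_self_form[OF W(1) y(1)] y unfolding W(2) by (simp add: u_def)
      also have "Re (y \<bullet>c y) = Re (v \<bullet>c v)"
        using adjoint_mult_self_form[OF cV v(1)] V v by (simp add: y_def unitary_mat_def)
      finally have "\<kappa> j * Re (u \<bullet>c u) \<le> (\<Sum>i<k. \<kappa> i * (cmod (v $ i))\<^sup>2)"
        using dominated_leading_sum[of k \<kappa> j v, OF \<kappa>_dec j supp v(1)] by simp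
      also have "\<dots> = Re ((K *\<^sub>v y) \<bullet>c y)"
        unfolding KV y_def by (rule unitary_diag_quadratic_image[OF V v(1), symmetric])
      finally have "\<kappa> j * Re (u \<bullet>c u) \<le> Re ((N *\<^sub>v (F a *\<^sub>v u)) \<bullet>c (F a *\<^sub>v u))"
        unfolding formK[OF y(1)] Zy .
      from form_chebyshev_bound[OF a m _ u less_imp_le[OF \<kappa>_pos[OF j]] this[unfolded N_def]] mono
      show ?thesis unfolding Zy G_def a2m by (simp add: m_def)
    qed
    ultimately show "(Z * V) *\<^sub>v v \<noteq> 0\<^sub>v d \<and> \<kappa> j * Re (((Z * V) *\<^sub>v v) \<bullet>c ((Z * V) *\<^sub>v v))
        \<le> Re ((G *\<^sub>v ((Z * V) *\<^sub>v v)) \<bullet>c ((Z * V) *\<^sub>v v))"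
      unfolding Qv by blast
  qed
  define L where "L = V * mat_diag k (\<lambda>i. complex_of_real (1 / sqrt (\<kappa> i)))"
  have L: "L \<in> carrier_mat k k" "mat_adjoint L * K * L = 1\<^sub>m k"
    unfolding L_def by (rule congruence_to_one[OF V KV \<kappa>_pos], assumption)+
  define P where "P = mat_adjoint L * D * L"
  have "mat_adjoint D = D" by (simp add: D_def mat_adjoint_diag)
  note P = congruence_hermitian[OF cD L(1) this, folded P_def]
  obtain V' p where V': "unitary_mat k V'"
    and PV: "P = V' * mat_diag k (\<lambda>i. complex_of_real (p i)) * mat_adjoint V'"
    and p_dec: "\<And>i j. i \<le> j \<Longrightarrow> j < k \<Longrightarrow> p j \<le> p i"
    using hermitian_eig_decomp[OF P] by blast
  have cV': "V' \<in> carrier_mat k k" using V' by (simp add: unitary_mat_def)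
  have formP: "(P *\<^sub>v t) \<bullet>c t = (D *\<^sub>v (L *\<^sub>v t)) \<bullet>c (L *\<^sub>v t)" if "t \<in> carrier_vec k" for t
    unfolding P_def by (rule congruence_form[OF cD L(1) that])
  have formKL: "(K *\<^sub>v (L *\<^sub>v t)) \<bullet>c (L *\<^sub>v t) = t \<bullet>c t" if "t \<in> carrier_vec k" for t
    using congruence_form[OF K(1) L(1) that] L(2) that by simp
  have L_nz: "L *\<^sub>v t \<noteq> 0\<^sub>v k" if t: "t \<in> carrier_vec k" "t \<noteq> 0\<^sub>v k" for t
  proof
    assume "L *\<^sub>v t = 0\<^sub>v k"
    then have "t \<bullet>c t = 0" using formKL[OF t(1)] by (simp add: mult_mat_vec_zero[OF K(1)])
    then show False using t by simp
  qed
  have p_pos: "0 < p j" if "j < k" for j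
  proof -
    obtain t where t: "t \<in> carrier_vec k" "t \<noteq> 0\<^sub>v k" "Re ((P *\<^sub>v t) \<bullet>c t) = p j"
      using unitary_diag_eigenvalue_form[OF V' \<open>j < k\<close>, of p] unfolding PV by blast
    then show ?thesis
      using D_pos[OF mult_mat_vec_carrier[OF L(1) t(1)] L_nz[OF t(1,2)]] formP[OF t(1)] by simp
  qed
  \<comment> \<open>The test vectors are \<open>w = X Z L t\<close> with \<open>t = V' v\<close> in
    the span of the leading eigenvectors of \<open>P\<close>. The form of \<open>K\<close> at
    \<open>L t\<close> is \<open>|t|^2 = |v|^2\<close>, so \<open>ratio\<close> reads
    \<open>|w|^4 \<le> <G w, w> |v|^2\<close>; combined with \<open>p j |v|^2 \<le> |w|^2\<close> it
    gives the bound.\<close>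
  have p_le: "p j \<le> eig_val (Suc j) G" if j: "j < k" for j
  proof (rule eig_val_ge[OF car(4) herm(2) mult_carrier_mat[OF cXZ mult_carrier_mat[OF L(1) cV']] j])
    show "j < d" using j k by simp
    fix v :: "complex vec"
    assume v: "v \<in> carrier_vec k" "v \<noteq> 0\<^sub>v k" and supp: "\<And>i. j < i \<Longrightarrow> i < k \<Longrightarrow> v $ i = 0"
    define t where "t = V' *\<^sub>v v"
    define y where "y = L *\<^sub>v t"
    define w where "w = X *\<^sub>v (Z *\<^sub>v y)"
    have t: "t \<in> carrier_vec k" "t \<noteq> 0\<^sub>v k"
      using cV' v unitary_adjoint_mult_cancel(2)[OF V' v] by (auto simp: t_def)
    have y: "y \<in> carrier_vec k" "y \<noteq> 0\<^sub>v k"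
      using L(1) t L_nz[OF t] by (auto simp: y_def)
    have w: "w \<in> carrier_vec d" using car cZ y by (simp add: w_def)
    have "(X * Z) * (L * V') *\<^sub>v v = (X * Z) *\<^sub>v ((L * V') *\<^sub>v v)"
      by (rule assoc_mult_mat_vec[OF cXZ mult_carrier_mat[OF L(1) cV'] v(1)])
    also have "(L * V') *\<^sub>v v = y"
      using assoc_mult_mat_vec[OF L(1) cV' v(1)] by (simp add: y_def t_def)
    finally have Qv: "(X * Z) * (L * V') *\<^sub>v v = w" by (simp add: XZv[OF y(1)] w_def)
    have ww: "Re (w \<bullet>c w) = Re ((D *\<^sub>v y) \<bullet>c y)" by (simp add: formD[OF y(1)] w_def)
    have w_pos: "0 < Re (w \<bullet>c w)" unfolding ww by (rule D_pos[OF y])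
    have tt: "Re (t \<bullet>c t) = Re (v \<bullet>c v)"
      using adjoint_mult_self_form[OF cV' v(1)] V' v by (simp add: t_def unitary_mat_def)
    have v_pos: "0 < Re (v \<bullet>c v)" by (rule Re_cscalar_prod_self(3)[OF v])
    have "p j * Re (v \<bullet>c v) \<le> (\<Sum>i<k. p i * (cmod (v $ i))\<^sup>2)"
      by (rule dominated_leading_sum[of k p j v, OF p_dec j supp v(1)])
    also have "\<dots> = Re ((P *\<^sub>v t) \<bullet>c t)"
      unfolding PV t_def by (rule unitary_diag_quadratic_image[OF V' v(1), symmetric])
    also have "\<dots> = Re (w \<bullet>c w)" by (simp add: formP[OF t(1)] ww y_def)
    finally have low: "p j * Re (v \<bullet>c v) \<le> Re (w \<bullet>c w)" .
    have "(p j * Re (w \<bullet>c w)) * Re (v \<bullet>c v) = (p j * Re (v \<bullet>c v)) * Re (w \<bullet>c w)" by simp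
    also have "\<dots> \<le> (Re (w \<bullet>c w))\<^sup>2"
      using mult_right_mono[OF low less_imp_le[OF w_pos]] by (simp add: power2_eq_square)
    also have "\<dots> \<le> Re ((G *\<^sub>v w) \<bullet>c w) * Re (v \<bullet>c v)"
      using ratio[OF y(1)] formKL[OF t(1)] tt by (simp add: ww[symmetric] w_def[symmetric] y_def[symmetric])
    finally have "p j * Re (w \<bullet>c w) \<le> Re ((G *\<^sub>v w) \<bullet>c w)" using v_pos by simp
    moreover have "w \<noteq> 0\<^sub>v d" using w_pos by auto
    ultimately show "(X * Z) * (L * V') *\<^sub>v v \<noteq> 0\<^sub>v d \<and>
        p j * Re (((X * Z) * (L * V') *\<^sub>v v) \<bullet>c ((X * Z) * (L * V') *\<^sub>v v))
        \<le> Re ((G *\<^sub>v ((X * Z) * (L * V') *\<^sub>v v)) \<bullet>c ((X * Z) * (L * V') *\<^sub>v v))"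
      unfolding Qv by blast
  qed
  \<comment> \<open>The factors \<open>det L\<close> and \<open>det (mat_adjoint L)\<close> move
    from \<open>D\<close> to \<open>K\<close>, where they complete the determinant of the
    identity.\<close>
  have "det P * det K = det D * det (mat_adjoint L * K * L)"
    unfolding P_def
    using det_mult[OF mult_carrier_mat[OF mat_adjoint_carrier[OF L(1)] cD] L(1)]
      det_mult[OF mat_adjoint_carrier[OF L(1)] cD]
      det_mult[OF mult_carrier_mat[OF mat_adjoint_carrier[OF L(1)] K(1)] L(1)]
      det_mult[OF mat_adjoint_carrier[OF L(1)] K(1)] by simp
  then have "det P * det K = det D" unfolding L(2) by simp
  then have "complex_of_real ((\<Prod>i<k. p i) * (\<Prod>i<k. \<kappa> i)) = complex_of_real (\<Prod>i<k. s i)"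
    unfolding PV KV D_def det_unitary_diag[OF V] det_unitary_diag[OF V'] det_mat_diag by simp
  then have "(\<Prod>i<k. s i) = (\<Prod>i<k. p i) * (\<Prod>i<k. \<kappa> i)" by (simp only: of_real_eq_iff)
  also have "\<dots> \<le> (\<Prod>i<k. eig_val (Suc i) G) * (\<Prod>i<k. eig_val (Suc i) G)"
    using p_pos \<kappa>_pos p_le \<kappa>_le
    by (intro mult_mono prod_mono prod_nonneg)
      (auto intro: less_imp_le order_trans[OF less_imp_le[OF p_pos]])
  finally show ?thesis by (simp add: power2_eq_square G_def)
qed

end

section \<open>Singular values and singular vectors\<close>

lemma leading_eigenvectors:
  assumes U: "unitary_mat d U" and k: "k \<le> d"
  obtains W where "W \<in> carrier_mat d k" "mat_adjoint W * W = 1\<^sub>m k"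
    "\<And>f. (U * mat_diag d f * mat_adjoint U) * W = W * mat_diag k f"
proof -
  \<comment> \<open>Right multiplication by \<open>J\<close> keeps the first \<open>k\<close>
    columns.\<close>
  define J where "J = mat d k (\<lambda>(i, j). if i = j then 1 else 0 :: complex)"
  have cU: "U \<in> carrier_mat d d" "mat_adjoint U \<in> carrier_mat d d" and UU: "mat_adjoint U * U = 1\<^sub>m d"
    using U by (auto simp: unitary_mat_def mat_adjoint_carrier)
  have cJ: "J \<in> carrier_mat d k" by (simp add: J_def)
  have JJ: "mat_adjoint J * J = 1\<^sub>m k"
  proof (rule eq_matI)
    fix i j assume "i < dim_row (1\<^sub>m k)" "j < dim_col (1\<^sub>m k)"
    then have ij: "i < k" "j < k" by auto
    have "(mat_adjoint J * J) $$ (i, j) = (\<Sum>l<d. cnj (J $$ (l, i)) * J $$ (l, j))"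
      using cJ ij by (auto simp: scalar_prod_def atLeast0LessThan intro!: sum.cong)
    also have "\<dots> = (\<Sum>l<d. if l = i then (if i = j then 1 else 0) else 0)"
      using ij by (intro sum.cong) (auto simp: J_def)
    finally show "(mat_adjoint J * J) $$ (i, j) = 1\<^sub>m k $$ (i, j)" using ij k by simp
  qed (use cJ in auto)
  have DJ: "mat_diag d f * J = J * mat_diag k f" for f :: "nat \<Rightarrow> complex"
    unfolding mat_diag_mult_left[OF cJ] mat_diag_mult_right[OF cJ]
    by (rule eq_matI) (auto simp: J_def)
  show thesis
  proof (rule that[of "U * J"])
    show "U * J \<in> carrier_mat d k" using cU cJ by simp
    have "mat_adjoint (U * J) * (U * J) = mat_adjoint J * ((mat_adjoint U * U) * J)"
      unfolding mat_adjoint_mult[OF cU(1) cJ]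
      using assoc_mult_mat[OF mat_adjoint_carrier[OF cJ] cU(2) mult_carrier_mat[OF cU(1) cJ]]
        assoc_mult_mat[OF cU(2,1) cJ] by simp
    also have "\<dots> = 1\<^sub>m k" unfolding UU using cJ JJ by simp
    finally show "mat_adjoint (U * J) * (U * J) = 1\<^sub>m k" .
    fix f :: "nat \<Rightarrow> complex"
    have cD: "mat_diag d f \<in> carrier_mat d d" by simp
    have "(U * mat_diag d f * mat_adjoint U) * (U * J) = (U * mat_diag d f) * ((mat_adjoint U * U) * J)"
      using assoc_mult_mat[OF mult_carrier_mat[OF cU(1) cD] cU(2) mult_carrier_mat[OF cU(1) cJ]]
        assoc_mult_mat[OF cU(2,1) cJ] by simp
    also have "\<dots> = U * (mat_diag d f * J)"
      unfolding UU using assoc_mult_mat[OF cU(1) cD cJ] cJ by simp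
    also have "\<dots> = (U * J) * mat_diag k f"
      unfolding DJ using assoc_mult_mat[OF cU(1) cJ mat_diag_dim] by simp
    finally show "(U * mat_diag d f * mat_adjoint U) * (U * J) = (U * J) * mat_diag k f" .
  qed
qed

lemma psd_eig_val_nonneg:
  assumes "psd d G" "j < d"
  shows "0 \<le> eig_val (Suc j) G"
proof -
  have "G \<in> carrier_mat d d" using assms by (simp add: psd_def)
  then obtain U r where U: "unitary_mat d U" and GU: "G = U * mat_diag d (\<lambda>i. complex_of_real (r i)) * mat_adjoint U"
    and ev: "\<And>j. j < d \<Longrightarrow> eig_val (Suc j) G = r j"
    using hermitian_eig_decomp[of G d] psd_hermitian[OF assms(1)] by metis
  show ?thesis
    using psd_eigenvalues_nonneg[OF assms(1)[unfolded GU] U assms(2)] ev[OF assms(2)] by simp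
qed

text \<open>Since \<open>sqrt\<close> preserves order, a diagonalisation of
  \<open>mat_adjoint T * T\<close> with decreasing entries also lists the eigenvalues of the
  absolute value in decreasing order.\<close>

lemma mat_abs_eig_decomp:
  fixes T :: "complex mat"
  assumes T: "T \<in> carrier_mat d d"
  obtains U r where "unitary_mat d U"
    "mat_adjoint T * T = U * mat_diag d (\<lambda>i. complex_of_real (r i)) * mat_adjoint U"
    "\<And>j. j < d \<Longrightarrow> 0 \<le> r j" "\<And>j. j < d \<Longrightarrow> eig_val (Suc j) (mat_abs T) = sqrt (r j)"
proof -
  have cS: "mat_adjoint T * T \<in> carrier_mat d d" using T mat_adjoint_carrier[OF T] by simp
  have "mat_adjoint (mat_adjoint T * T) = mat_adjoint T * T"
    using mat_adjoint_mult[OF mat_adjoint_carrier[OF T] T] by simp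
  note S = cS this
  have psdS: "psd d (mat_adjoint T * T)"
    using adjoint_mult_self_form[OF T] Re_cscalar_prod_self(2)[OF mult_mat_vec_carrier[OF T]]
    by (intro psdI[OF S]) simp
  obtain U r where U: "unitary_mat d U"
    and SU: "mat_adjoint T * T = U * mat_diag d (\<lambda>i. complex_of_real (r i)) * mat_adjoint U"
    and dec: "\<And>i j. i \<le> j \<Longrightarrow> j < d \<Longrightarrow> r j \<le> r i"
    using hermitian_eig_decomp[OF S] by metis
  have "mat_abs T = U * mat_diag d (\<lambda>i. complex_of_real (sqrt (r i))) * mat_adjoint U"
    unfolding mat_abs_def by (rule mat_fun_eqI) (use U SU in \<open>auto simp: spectral_fun_def\<close>)
  then have "eig_val (Suc j) (mat_abs T) = sqrt (r j)" if "j < d" for j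
    using eig_val_unitary_diag[OF U, of "\<lambda>i. sqrt (r i)"] dec that by simp
  moreover have "0 \<le> r j" if "j < d" for j
    by (rule psd_eigenvalues_nonneg[OF psdS[unfolded SU] U that])
  ultimately show thesis using that[OF U SU] by blast
qed

context positive_diagonal_map
begin

text \<open>If one of the first \<open>k\<close> singular values vanishes, the left side is 0 and
  the right side is non-negative. Otherwise the leading left singular vectors form an isometry to
  which \<open>prod_eig_val_bound\<close> applies with \<open>s = r\<close>, and the claim is the
  square root of that bound.\<close>

lemma prod_eig_val_mat_abs_le:
  assumes a: "\<forall>i<n. 0 \<le> a i" and b: "\<forall>i<n. 0 \<le> b i"
    and ab: "\<And>i. i < n \<Longrightarrow> a i = 0 \<Longrightarrow> b i = 0"
    and mono: "\<And>i j. i < n \<Longrightarrow> j < n \<Longrightarrow> 0 \<le> (a i - a j) * (b i / a i - b j / a j)"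
    and k: "k \<le> d"
  shows "(\<Prod>i<k. eig_val (Suc i) (mat_abs (F a * F b))) \<le> (\<Prod>i<k. eig_val (Suc i) (F (\<lambda>i. a i * b i)))"
proof -
  define T where "T = F a * F b"
  note ca = F_carrier[OF a] and cb = F_carrier[OF b]
  have T: "T \<in> carrier_mat d d" using ca cb by (simp add: T_def)
  have adT: "mat_adjoint T = F b * F a"
    unfolding T_def mat_adjoint_mult[OF ca cb] F_hermitian[OF a] F_hermitian[OF b] ..
  have cT: "mat_adjoint T \<in> carrier_mat d d" using T by (rule mat_adjoint_carrier)
  obtain U r where U: "unitary_mat d U"
    and SU: "mat_adjoint T * T = U * mat_diag d (\<lambda>i. complex_of_real (r i)) * mat_adjoint U"
    and r: "\<And>j. j < d \<Longrightarrow> 0 \<le> r j"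
    and ev: "\<And>j. j < d \<Longrightarrow> eig_val (Suc j) (mat_abs T) = sqrt (r j)"
    using mat_abs_eig_decomp[OF T] by metis
  have lhs: "(\<Prod>i<k. eig_val (Suc i) (mat_abs T)) = (\<Prod>i<k. sqrt (r i))"
    using k by (intro prod.cong) (auto simp: ev)
  have "\<forall>i<n. 0 \<le> a i * b i" using a b by auto
  then have rhs: "0 \<le> (\<Prod>i<k. eig_val (Suc i) (F (\<lambda>i. a i * b i)))"
    using k by (intro prod_nonneg ballI psd_eig_val_nonneg[OF psd_F]) auto
  show ?thesis
  proof (cases "\<exists>i<k. r i = 0")
    case True
    then have z: "(\<Prod>i<k. sqrt (r i)) = 0" by auto
    show ?thesis unfolding T_def[symmetric] lhs z by (rule rhs)
  next
    case False
    then have r_pos: "0 < r i" if "i < k" for i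
      using r[of i] that k by force
    obtain W0 where W0: "W0 \<in> carrier_mat d k" "mat_adjoint W0 * W0 = 1\<^sub>m k"
      and SW0: "(mat_adjoint T * T) * W0 = W0 * mat_diag k (\<lambda>i. complex_of_real (r i))"
      using leading_eigenvectors[OF U k] unfolding SU by metis
    note cW0 = mat_adjoint_carrier[OF W0(1)]
    define D where "D f = mat_diag k (\<lambda>i. complex_of_real (f i))" for f :: "nat \<Rightarrow> real"
    define g where "g i = 1 / sqrt (r i)" for i
    have cD: "D f \<in> carrier_mat k k" for f by (simp add: D_def)
    have adD: "mat_adjoint (D f) = D f" for f by (simp add: D_def mat_adjoint_diag)
    have DD: "D f * D h = D (\<lambda>i. f i * h i)" for f h by (simp add: D_def)
    have D_cong: "D f = D h" if "\<And>i. i < k \<Longrightarrow> f i = h i" for f h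
      using that by (auto simp: D_def mat_diag_def)
    have SW0': "(mat_adjoint T * T) * W0 = W0 * D r" using SW0 by (simp add: D_def)
    define V where "V = W0 * D g"
    have cV: "V \<in> carrier_mat d k" using W0 cD by (simp add: V_def)
    have adV: "mat_adjoint V = D g * mat_adjoint W0"
      unfolding V_def mat_adjoint_mult[OF W0(1) cD] adD ..
    \<comment> \<open>The columns of \<open>W\<close> are the normalised left singular vectors of \<open>T\<close>, which trade
      \<open>T\<^sup>*T\<close> for \<open>TT\<^sup>* = F a * F b * F b * F a\<close>.\<close>
    define W where "W = T * V"
    have cW: "W \<in> carrier_mat d k" using T cV by (simp add: W_def)
    have adW: "mat_adjoint W = mat_adjoint V * mat_adjoint T"
      unfolding W_def mat_adjoint_mult[OF T cV] ..
    have TTV: "(mat_adjoint T * T) * V = W0 * D (\<lambda>i. r i * g i)"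
    proof -
      have "(mat_adjoint T * T) * V = ((mat_adjoint T * T) * W0) * D g"
        unfolding V_def by (rule assoc_mult_mat[symmetric, OF mult_carrier_mat[OF cT T] W0(1) cD])
      also have "\<dots> = W0 * D (\<lambda>i. r i * g i)"
        unfolding SW0' assoc_mult_mat[OF W0(1) cD cD] DD ..
      finally show ?thesis .
    qed
    have TW: "mat_adjoint T * W = W0 * D (\<lambda>i. r i * g i)"
      unfolding W_def using assoc_mult_mat[OF cT T cV] TTV by simp
    \<comment> \<open>As \<open>g = r^{-1/2}\<close>, the first identity makes the columns of
      \<open>W\<close> orthonormal; the second squares \<open>r g\<close>, which is the singular
      value itself.\<close>
    have gr: "g i * (r i * g i) = 1" "r i * g i * (r i * g i) = r i" if "i < k" for i
      using r_pos[OF that] by (auto simp: g_def field_simps)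
    have W0D: "mat_adjoint W0 * (W0 * D f) = D f" for f
      using assoc_mult_mat[OF cW0 W0(1) cD, of f] W0(2) cD[of f] by simp
    have "mat_adjoint W * W = mat_adjoint V * (mat_adjoint T * W)"
      unfolding adW by (rule assoc_mult_mat[OF mat_adjoint_carrier[OF cV] cT cW])
    also have "\<dots> = D g * (mat_adjoint W0 * (W0 * D (\<lambda>i. r i * g i)))"
      unfolding TW adV by (rule assoc_mult_mat[OF cD cW0 mult_carrier_mat[OF W0(1) cD]])
    also have "\<dots> = D (\<lambda>_. 1)"
      unfolding W0D DD by (rule D_cong) (rule gr)
    also have "\<dots> = 1\<^sub>m k" by (simp add: D_def)
    finally have WW: "mat_adjoint W * W = 1\<^sub>m k" .
    have "F b * (F a * W) = W0 * D (\<lambda>i. r i * g i)"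
      using assoc_mult_mat[OF cb ca cW] TW by (simp add: adT)
    then have "mat_adjoint (F b * (F a * W)) * (F b * (F a * W))
        = D (\<lambda>i. r i * g i) * mat_adjoint W0 * (W0 * D (\<lambda>i. r i * g i))"
      by (simp add: mat_adjoint_mult[OF W0(1) cD] adD)
    also have "\<dots> = D (\<lambda>i. r i * g i) * (mat_adjoint W0 * (W0 * D (\<lambda>i. r i * g i)))"
      by (rule assoc_mult_mat[OF cD cW0 mult_carrier_mat[OF W0(1) cD]])
    also have "\<dots> = D r"
      unfolding W0D DD by (rule D_cong) (rule gr)
    finally have eqD: "mat_adjoint (F b * (F a * W)) * (F b * (F a * W)) = mat_diag k (\<lambda>i. complex_of_real (r i))"
      unfolding D_def .
    have "(\<Prod>i<k. r i) \<le> (\<Prod>i<k. eig_val (Suc i) (F (\<lambda>i. a i * b i)))\<^sup>2"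
      by (rule prod_eig_val_bound[OF a b _ _ cW WW k eqD]) (fact ab mono r_pos)+
    also have "(\<Prod>i<k. r i) = (\<Prod>i<k. sqrt (r i))\<^sup>2"
      unfolding prod_power_distrib using r_pos by (intro prod.cong) (auto simp: less_imp_le)
    finally have "(\<Prod>i<k. sqrt (r i)) \<le> (\<Prod>i<k. eig_val (Suc i) (F (\<lambda>i. a i * b i)))"
      using rhs by (rule power2_le_imp_le)
    then show ?thesis unfolding T_def[symmetric] lhs .
  qed
qed

end

subsection \<open>Concave functions and unital positive maps\<close>

text \<open>A drop between \<open>x\<close> and \<open>y\<close> would, by concavity, persist at
  least linearly to the right and end below 0.\<close>

lemma concave_nonneg_mono:
  fixes h :: "real \<Rightarrow> real"
  assumes h: "h \<in> {0..} \<rightarrow> {0..}" "concave_on {0..} h" and xy: "0 \<le> x" "x \<le> y"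
  shows "h x \<le> h y"
proof (rule ccontr)
  assume "\<not> h x \<le> h y"
  then have lt: "h y < h x" by simp
  have "0 \<le> h y" using h(1) xy by auto
  \<comment> \<open>This \<open>t\<close> makes \<open>(1 - t) * h x\<close> the mean of
    \<open>h x\<close> and \<open>h y\<close>, which exceeds \<open>h y\<close>; the point
    \<open>z\<close> is then placed so that \<open>y\<close> divides the segment from
    \<open>x\<close> to \<open>z\<close> in the ratio given by \<open>t\<close>.\<close>
  define t where "t = (h x - h y) / (2 * h x)"
  have t: "0 < t" "t \<le> 1" using lt \<open>0 \<le> h y\<close> by (auto simp: t_def field_simps)
  define z where "z = x + (y - x) / t"
  have z: "0 \<le> z" using xy t by (simp add: z_def)
  have "(1 - t) * x + t * z = y" using t by (simp add: z_def field_simps)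
  then have conc: "(1 - t) * h x + t * h z \<le> h y"
    using concave_onD[OF h(2), of t x z] t xy z by simp
  have "0 \<le> t * h z" using t z h(1) by (auto intro!: mult_nonneg_nonneg)
  then have "(1 - t) * h x \<le> h y" using conc by simp
  moreover have "(1 - t) * h x = (h x + h y) / 2" using lt \<open>0 \<le> h y\<close> by (simp add: t_def field_simps)
  ultimately show False using lt by simp
qed

text \<open>The graph lies above the chord from 0 to \<open>y\<close>, and since
  \<open>h 0 \<ge> 0\<close> that chord lies above the segment from the origin.\<close>

lemma concave_nonneg_ratio:
  fixes h :: "real \<Rightarrow> real"
  assumes h: "h \<in> {0..} \<rightarrow> {0..}" "concave_on {0..} h" and xy: "0 \<le> x" "x \<le> y"
  shows "x * h y \<le> y * h x"
proof (cases "y = 0")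
  case False
  then have y: "0 < y" using xy by simp
  have "(1 - x / y) * h 0 + x / y * h y \<le> h x"
    using concave_onD[OF h(2), of "x / y" 0 y] xy y by simp
  moreover have "0 \<le> (1 - x / y) * h 0" using xy y h(1) by (intro mult_nonneg_nonneg) auto
  ultimately have "x / y * h y \<le> h x" by simp
  then show ?thesis using y by (simp add: field_simps)
qed (use xy in auto)

lemma concave_ratio_comonotone:
  fixes h :: "real \<Rightarrow> real"
  assumes h: "h \<in> {0..} \<rightarrow> {0..}" "concave_on {0..} h" and xy: "0 \<le> x" "0 \<le> y"
  shows "0 \<le> (h x - h y) * (x / h x - y / h y)"
proof -
  have *: "0 \<le> (h y - h x) * (y / h y - x / h x)" if xy: "0 \<le> x" "x \<le> y" for x y
  proof (intro mult_nonneg_nonneg)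
    have le: "h x \<le> h y" by (rule concave_nonneg_mono[OF h xy])
    then show "0 \<le> h y - h x" by simp
    have "0 \<le> h x" "0 \<le> h y" using h(1) xy by auto
    show "0 \<le> y / h y - x / h x"
    \<comment> \<open>If \<open>h x = 0\<close>, then \<open>x / h x\<close> is 0 by convention,
      which is below any non-negative quotient, so the order is kept.\<close>
    proof (cases "h x = 0")
      case False
      then have "0 < h x" "0 < h y" using \<open>0 \<le> h x\<close> le by auto
      then show ?thesis using concave_nonneg_ratio[OF h xy] by (simp add: field_simps)
    qed (use xy \<open>0 \<le> h y\<close> in auto)
  qed
  show ?thesis
  proof (cases "x \<le> y")
    case True
    from *[OF xy(1) this] show ?thesis by (simp add: algebra_simps)
  qed (use *[OF xy(2)] in auto)
qed

text \<open>Left of the zero \<open>x\<close> the function vanishes by monotonicity, right of it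
  because \<open>h y / y\<close> cannot increase.\<close>

lemma concave_nonneg_zero:
  fixes h :: "real \<Rightarrow> real"
  assumes h: "h \<in> {0..} \<rightarrow> {0..}" "concave_on {0..} h" and x: "0 < x" "h x = 0" and y: "0 \<le> y"
  shows "h y = 0"
proof -
  have "0 \<le> h y" using h(1) y by auto
  moreover have "h y \<le> 0"
  proof (cases "y \<le> x")
    case True
    then show ?thesis using concave_nonneg_mono[OF h y True] x by simp
  next
    case False
    then have "x * h y \<le> 0" using concave_nonneg_ratio[OF h, of x y] x by simp
    then show ?thesis using x by (simp add: mult_le_0_iff)
  qed
  ultimately show ?thesis by simp
qed

section \<open>The map on matrices diagonal in a fixed eigenbasis\<close>

lemma positive_unital_diagonal_map:
  fixes \<Phi> :: "complex mat \<Rightarrow> complex mat"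
  assumes lin: "linear_mat_map n d \<Phi>" and pos: "positive_map n d \<Phi>" and unit: "unital_map n d \<Phi>"
    and U: "unitary_mat n U"
  defines "F \<equiv> \<lambda>x. \<Phi> (U * mat_diag n (\<lambda>i. complex_of_real (x i)) * mat_adjoint U)"
  shows "positive_diagonal_map n d F (\<lambda>i. F (\<lambda>j. if j = i then 1 else 0))"
proof -
  define M where "M x = U * mat_diag n (\<lambda>i. complex_of_real (x i)) * mat_adjoint U" for x :: "nat \<Rightarrow> real"
  have F: "F x = \<Phi> (M x)" for x by (simp add: F_def M_def)
  have cU: "U \<in> carrier_mat n n" "mat_adjoint U \<in> carrier_mat n n"
    using U by (auto simp: unitary_mat_def mat_adjoint_carrier)
  have cM: "M x \<in> carrier_mat n n" for x
    unfolding M_def by (rule mult_carrier_mat[OF mult_carrier_mat[OF cU(1) mat_diag_dim] cU(2)])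
  have cF: "F x \<in> carrier_mat d d" for x using lin cM[of x] by (auto simp: F linear_mat_map_def)
  have hermM: "mat_adjoint (M x) = M x" for x
    unfolding M_def mat_adjoint_mult3[OF cU(1) mat_diag_dim cU(2)] mat_adjoint_diag
    using assoc_mult_mat[OF cU(1) mat_diag_dim cU(2)] by simp
  have psd_F: "psd d (F x)" if "\<forall>i<n. 0 \<le> x i" for x
  proof -
    have "0 \<le> Re ((M x *\<^sub>v v) \<bullet>c v)" if "v \<in> carrier_vec n" for v
      unfolding M_def unitary_diag_quadratic(1)[OF U that] using \<open>\<forall>i<n. 0 \<le> x i\<close>
      by (intro sum_nonneg mult_nonneg_nonneg) auto
    then have "psd n (M x)" by (rule psdI[OF cM hermM])
    then show ?thesis using pos by (simp add: F positive_map_def)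
  qed
  have M_add: "M (\<lambda>i. x i + c * y i) = M x + complex_of_real c \<cdot>\<^sub>m M y" for x y c
  proof -
    have "mat_diag n (\<lambda>i. complex_of_real (x i + c * y i))
        = mat_diag n (\<lambda>i. complex_of_real (x i)) + complex_of_real c \<cdot>\<^sub>m mat_diag n (\<lambda>i. complex_of_real (y i))"
      by (rule eq_matI) (auto simp: mat_diag_def)
    then show ?thesis
      unfolding M_def using cU
      by (simp add: mult_add_distrib_mat[of _ n n _ n] add_mult_distrib_mat[of _ n n _ _ n]
          mult_smult_distrib[of _ n n _ n] mult_smult_assoc_mat[of _ n n _ n])
  qed
  have F_add: "F (\<lambda>i. x i + c * y i) = F x + complex_of_real c \<cdot>\<^sub>m F y" for x y c
    using lin cM[of x] cM[of y] unfolding F M_add by (simp add: linear_mat_map_def)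
  have F_cong: "F x = F y" if "\<And>i. i < n \<Longrightarrow> x i = y i" for x y
  proof -
    have "mat_diag n (\<lambda>i. complex_of_real (x i)) = mat_diag n (\<lambda>i. complex_of_real (y i))"
      using that by (intro eq_matI) (auto simp: mat_diag_def)
    then show ?thesis by (simp add: F_def)
  qed
  have form_add: "Re ((F (\<lambda>i. x i + c * y i) *\<^sub>v v) \<bullet>c w) = Re ((F x *\<^sub>v v) \<bullet>c w) + c * Re ((F y *\<^sub>v v) \<bullet>c w)"
    if "v \<in> carrier_vec d" "w \<in> carrier_vec d" for x c y v w
  proof -
    have "F (\<lambda>i. x i + c * y i) *\<^sub>v v = F x *\<^sub>v v + complex_of_real c \<cdot>\<^sub>v (F y *\<^sub>v v)"
      unfolding F_add using cF[of x] cF[of y] that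
      by (simp add: add_mult_distrib_mat_vec[of _ d d]) (auto intro!: eq_vecI)
    then have "(F (\<lambda>i. x i + c * y i) *\<^sub>v v) \<bullet>c w = (F x *\<^sub>v v) \<bullet>c w + complex_of_real c * ((F y *\<^sub>v v) \<bullet>c w)"
      using that mult_mat_vec_carrier[OF cF[of x] that(1)] mult_mat_vec_carrier[OF cF[of y] that(1)]
      by (simp add: add_scalar_prod_distrib[of _ d])
    then show ?thesis by simp
  qed
  have F_form: "Re ((F x *\<^sub>v v) \<bullet>c w) = (\<Sum>i<n. x i * Re ((F (\<lambda>j. if j = i then 1 else 0) *\<^sub>v v) \<bullet>c w))"
    if vw: "v \<in> carrier_vec d" "w \<in> carrier_vec d" for x v w
  proof -
    \<comment> \<open>Truncations of \<open>x\<close> add one coordinate at a time; at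
      \<open>k = n\<close> the truncation has the same image as \<open>x\<close>, since
      \<open>F\<close> sees only the values below \<open>n\<close>.\<close>
    have "Re ((F (\<lambda>i. if i < k then x i else 0) *\<^sub>v v) \<bullet>c w)
        = (\<Sum>i<k. x i * Re ((F (\<lambda>j. if j = i then 1 else 0) *\<^sub>v v) \<bullet>c w))" for k
    proof (induction k)
      case 0
      \<comment> \<open>Adding zero to zero shows that the value at zero equals its own
        double.\<close>
      show ?case using form_add[OF vw, of "\<lambda>_. 0" 1 "\<lambda>_. 0"] by simp
    next
      case (Suc k)
      have "(\<lambda>i. if i < Suc k then x i else 0)
          = (\<lambda>i. (if i < k then x i else 0) + x k * (if i = k then 1 else 0))"
        by (auto simp: less_Suc_eq)
      then show ?case
        using form_add[OF vw, of "\<lambda>i. if i < k then x i else 0" "x k" "\<lambda>i. if i = k then 1 else 0"] Suc.IH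
        by simp
    qed
    from this[of n] show ?thesis using F_cong[of "\<lambda>i. if i < n then x i else 0" x] by simp
  qed
  show ?thesis
  proof
    show "\<forall>i<n. psd d (F (\<lambda>j. if j = i then 1 else 0))" by (auto intro: psd_F)
    show "F (\<lambda>_. 1) = 1\<^sub>m d"
      using unit unitary_mat_right_inverse[OF U] cU by (simp add: F_def unital_map_def)
  qed (fact psd_F F_form)+
qed

theorem corollary2p5:
  fixes n d :: nat and A B :: "complex mat" and \<Phi> :: "complex mat \<Rightarrow> complex mat"
  assumes "concave_monotone_pair n A B"
    and "linear_mat_map n d \<Phi>"
    and "positive_map n d \<Phi>"
    and "unital_map n d \<Phi>"
  shows "weak_log_majorized d (mat_abs (\<Phi> A * \<Phi> B)) (\<Phi> (A * B))"
proof -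
  obtain C g h where C: "psd n C" and g: "g \<in> {0..} \<rightarrow> {0..}" and BC: "B = mat_fun g C"
    and h: "h \<in> {0..} \<rightarrow> {0..}" "concave_on {0..} h" and AB: "A = mat_fun h B"
    using assms(1) unfolding concave_monotone_pair_def monotone_pair_def by blast
  have "C \<in> carrier_mat n n" using C by (simp add: psd_def)
  then obtain U c where U: "unitary_mat n U"
    and CU: "C = U * mat_diag n (\<lambda>i. complex_of_real (c i)) * mat_adjoint U"
    using hermitian_eig_decomp[of C n] psd_hermitian[OF C] by metis
  define b where "b i = g (c i)" for i
  define a where "a i = h (b i)" for i
  define D where "D x = mat_diag n (\<lambda>i. complex_of_real (x i))" for x :: "nat \<Rightarrow> real"
  define F where "F x = \<Phi> (U * D x * mat_adjoint U)" for x
  have b: "0 \<le> b i" if "i < n" for i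
    using psd_eigenvalues_nonneg[OF C[unfolded CU] U that] g by (auto simp: b_def)
  then have a: "0 \<le> a i" if "i < n" for i
    using h(1) that by (auto simp: a_def)
  have BU: "B = U * D b * mat_adjoint U"
    unfolding BC by (rule mat_fun_eqI) (use U CU in \<open>auto simp: spectral_fun_def b_def D_def\<close>)
  \<comment> \<open>The decomposition of \<open>B\<close> just found serves for \<open>h\<close> as
    well, so \<open>A\<close> and \<open>B\<close> are diagonal in the same basis with entries
    linked by \<open>a i = h (b i)\<close>.\<close>
  have AU: "A = U * D a * mat_adjoint U"
    unfolding AB by (rule mat_fun_eqI) (use U BU in \<open>auto simp: spectral_fun_def a_def D_def\<close>)
  have cU: "U \<in> carrier_mat n n" "mat_adjoint U \<in> carrier_mat n n" "mat_adjoint U * U = 1\<^sub>m n"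
    using U by (auto simp: unitary_mat_def mat_adjoint_carrier)
  have cD: "D x \<in> carrier_mat n n" for x by (simp add: D_def)
  have DD: "D x * D y = D (\<lambda>i. x i * y i)" for x y by (simp add: D_def)
  note ass = assoc_mult_mat[of _ n n _ n _ n] mult_carrier_mat[of _ n n _ n]
  have "A * B = U * D a * ((mat_adjoint U * U) * (D b * mat_adjoint U))"
    unfolding AU BU using cU(1,2) cD[of a] cD[of b] by (simp add: ass)
  also have "\<dots> = U * (D a * D b) * mat_adjoint U"
    unfolding cU(3) using cU(1,2) cD[of a] cD[of b] by (simp add: ass)
  finally have ABU: "A * B = U * D (\<lambda>i. a i * b i) * mat_adjoint U" unfolding DD .
  interpret positive_diagonal_map n d F "\<lambda>i. F (\<lambda>j. if j = i then 1 else 0)"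
    unfolding F_def D_def by (rule positive_unital_diagonal_map[OF assms(2,3,4) U])
  have D_cong: "D x = D y" if "\<And>i. i < n \<Longrightarrow> x i = y i" for x y
    using that by (auto simp: D_def mat_diag_def)
  \<comment> \<open>If \<open>a i = 0 < b i\<close> for some \<open>i\<close> then \<open>h\<close> vanishes identically; replacing \<open>b\<close> by \<open>b'\<close> removes
    this degenerate case without changing \<open>F a * F b\<close>.\<close>
  define b' where "b' i = (if a i = 0 then 0 else b i)" for i
  have b': "\<forall>i<n. 0 \<le> b' i" using b by (simp add: b'_def)
  have "F a * F b' = F a * F b"
  proof (cases "\<exists>i<n. a i = 0 \<and> b i \<noteq> 0")
    case True
    then obtain i where i: "i < n" "h (b i) = 0" "0 < b i" using b by (force simp: a_def)
    then have "D a = D (\<lambda>_. 0)"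
      using concave_nonneg_zero[OF h i(3,2)] b by (intro D_cong) (auto simp: a_def)
    \<comment> \<open>Writing the zero matrix as a scalar multiple lets homogeneity of
      \<open>\<Phi>\<close> give \<open>F a = 0\<close>.\<close>
    also have "\<dots> = 0 \<cdot>\<^sub>m D (\<lambda>_. 0)" by (rule eq_matI) (auto simp: D_def mat_diag_def)
    finally have "F a = \<Phi> (0 \<cdot>\<^sub>m (U * D (\<lambda>_. 0) * mat_adjoint U))"
      using mult_smult_distrib[OF cU(1) cD] mult_smult_assoc_mat[OF mult_carrier_mat[OF cU(1) cD] cU(2)]
      by (simp add: F_def)
    also have "\<dots> = 0 \<cdot>\<^sub>m F (\<lambda>_. 0)"
      using assms(2) cU(1,2) cD[of "\<lambda>_. 0"] by (simp add: linear_mat_map_def F_def)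
    also have "\<dots> = 0\<^sub>m d d" using F_carrier[of "\<lambda>_. 0"] by auto
    finally show ?thesis using F_carrier[OF b'] F_carrier[of b] b by simp
  next
    case False
    then have "D b' = D b" by (intro D_cong) (auto simp: b'_def)
    then show ?thesis by (simp add: F_def)
  qed
  moreover have "(\<lambda>i. a i * b' i) = (\<lambda>i. a i * b i)" by (auto simp: b'_def)
  moreover have "0 \<le> (a i - a j) * (b' i / a i - b' j / a j)" if "i < n" "j < n" for i j
  proof -
    \<comment> \<open>Where \<open>a i = 0\<close> both quotients are 0 by convention, so passing to
      \<open>b'\<close> leaves the ratios unchanged.\<close>
    have ratio: "b' i / a i = b i / a i" for i by (simp add: b'_def)
    show ?thesis unfolding ratio unfolding a_def
      by (rule concave_ratio_comonotone[OF h b[OF that(1)] b[OF that(2)]])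
  qed
  ultimately have "(\<Prod>i<k. eig_val (Suc i) (mat_abs (F a * F b))) \<le> (\<Prod>i<k. eig_val (Suc i) (F (\<lambda>i. a i * b i)))"
    if "k \<le> d" for k
    using prod_eig_val_mat_abs_le[of a b' k] a b' that by (simp add: b'_def)
  \<comment> \<open>The products over \<open>1..k\<close> are reindexed to start at 0, matching
    \<open>eig_val (Suc i)\<close>.\<close>
  then show ?thesis
    unfolding weak_log_majorized_def ABU unfolding AU BU F_def[symmetric]
    by (simp add: prod.atLeast1_atMost_eq)
qed

end
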